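(* Let $\varphi$ be an MPNL formula. If there exists a $\mathbb{Z}$-compass generator $\mathcal{G}=(\mathbb{P}_{\mathbb{D}},\mathcal{L})$ that features $\varphi$, then there exists a $\mathbb{Z}$-compass generator $\mathcal{G}'=(\mathbb{P}_{\mathbb{D}'},\mathcal{L}')$ that features $\varphi$ with $|D'|\le\left(2^{3|\varphi|+1}+4\right)\cdot\left(\frac{|\varphi|^2}{4}+\frac{|\varphi|}{2}+1\right)^{2^{3|\varphi|}}+1$.
   Context: $|\varphi|$ is the length of $\varphi$. MPNL formulae: $\varphi ::= len_{<k} \mid p \mid \neg\varphi \mid \varphi\vee\varphi \mid \lozenge_l\varphi \mid \lozenge_r\varphi$ ($p$ atomic, $k\in\mathbb{N}$), interpreted over intervals $[x,y]$, $x\le y$: $len_{<k}$ holds iff $|x-y|<k$; $\lozenge_l\psi$ holds at $[x,y]$ iff $\psi$ holds at some $[z,x]$; $\lozenge_r\psi$ holds at $[x,y]$ iff $\psi$ holds at some $[y,z]$. $Cl(\varphi)$: subformulae of $\varphi$ and their negations (identifying $\neg\neg\alpha$ with $\alpha$, $\neg\lozenge_r\alpha$ with $\Box_r\neg\alpha$, etc.). A $\varphi$-atom is a non-empty $F\subseteq Cl(\varphi)$ with: $\alpha\in F$ iff $\neg\alpha\notin F$; $\alpha\vee\beta\in F$ iff $\alpha\in F$ or $\beta\in F$; for $k<k'$, $len_{<k}\in F$ implies $len_{<k'}\in F$. $\mathcal{A}_\varphi$ is the set of atoms. $Obs_r(F)=\{\psi\in F:\lozenge_r\psi\in Cl(\varphi)\}$,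 $Obs_l(F)=\{\psi\in F:\lozenge_l\psi\in Cl(\varphi)\}$, $Req_r(F)=\{\psi:\lozenge_r\psi\in F\}$, $Req_l(F)=\{\psi:\lozenge_l\psi\in F\}$; $F\,R\,G$ iff $Obs_r(G)\subseteq Req_r(F)$ and $Obs_l(F)\subseteq Req_l(G)$. A compass $\varphi$-structure over $D$ is $(\mathbb{P}_{\mathbb{D}},\mathcal{L})$ with $\mathbb{P}_{\mathbb{D}}=\{(x,y)\in D^2:x\le y\}$ and $\mathcal{L}$ assigning atoms to points such that: if $y=x'$ then $\mathcal{L}(x,y)\,R\,\mathcal{L}(x',y')$; and $len_{<k}\in\mathcal{L}(x,y)$ implies $y-x<k$. It features $\psi$ if $\psi\in\mathcal{L}(x,y)$ for some point. The $\lozenge_l$-requests of a point $(x,y)$ are fulfilled if each $\psi\in Req_l(\mathcal{L}(x,y))$ occurs in some $\mathcal{L}(x',x)$. $k_\varphi$ is the maximum $k$ occurring in some $len_{<k}$ in $\varphi$ ($0$ if none). Marking: $\mathcal{M}(x,y)=(F,\Psi,h)$ with $F=\mathcal{L}(x,y)$, $\Psi=\{\psi\in Req_r(\mathcal{L}(x,x)):\psi\notin\mathcal{L}(x,y')\text{ for all }x\le y'\le y\}$, $h=\min(y-x,k_\varphi)$. Marked atoms are triples in $\mathcal{A}^{\mathcal{M}}_\varphi\subseteq\mathcal{A}_\varphi\times2^{Cl(\varphi)}\times\{0,\ldots,k_\varphi\}$. Horizontal configuration: $\mathcal{C}_y(F,\Psi,h)=|\{x:\mathcal{M}(x,y)=(F,\Psi,h)\}|$.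 A $\mathbb{Z}$-compass generator for $\varphi$ is a finite compass $\varphi$-structure over an integer interval $D=\{y_{min},\ldots,y_{max}\}$ for which there exist $y_{past},y_{fut}\in D$ with $y_{past}<0<y_{fut}$, $y_{past}-y_{min}\ge k_\varphi$ and $y_{max}-y_{fut}\ge k_\varphi$, such that: (1) all $\lozenge_l$-requests of every point $(y,y)$ with $y_{past}\le y\le y_{max}$ are fulfilled; (2) for every marked atom $(F,\Psi,h)$, if $\mathcal{C}_{y_{max}}(F,\Psi,h)>0$ then $\mathcal{C}_{y_{fut}}(F,\Psi,h)>0$, and for every $y_{min}\le x\le y_{fut}$, $\mathcal{M}(x,y_{max})$ has the form $(F,\emptyset,h)$; (3) for every marked atom $(F,\Psi,h)$, if $\mathcal{C}_{y_{past}}(F,\Psi,h)>0$ then there exists $y_{past}\le x\le 0$ with $\mathcal{M}(x,0)=(F,\Psi,h)$. *)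

theory Defs
  imports Complex_Main "HOL-Library.Log_Nat"
begin

datatype 'p mpnl =
    LenLt nat
  | Atom 'p
  | Not "'p mpnl"
  | Or "'p mpnl" "'p mpnl"
  | DiaL "'p mpnl"
  | DiaR "'p mpnl"

text \<open>
  Length of a formula as a string of symbols. Length constraints are encoded in binary, so
  \<open>LenLt k\<close> contributes one symbol plus the number of binary digits of \<open>k\<close> (one digit for
  \<open>k = 0\<close>, where \<open>floorlog 2 0 = 0\<close>).
\<close>

fun mpnl_length :: "'p mpnl \<Rightarrow> nat" where
  "mpnl_length (LenLt k) = 1 + max 1 (floorlog 2 k)"
| "mpnl_length (Atom p) = 1"
| "mpnl_length (Not \<alpha>) = 1 + mpnl_length \<alpha>"
| "mpnl_length (Or \<alpha> \<beta>) = 1 + mpnl_length \<alpha> + mpnl_length \<beta>"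
| "mpnl_length (DiaL \<alpha>) = 1 + mpnl_length \<alpha>"
| "mpnl_length (DiaR \<alpha>) = 1 + mpnl_length \<alpha>"

fun subformulae :: "'p mpnl \<Rightarrow> 'p mpnl set" where
  "subformulae (LenLt k) = {LenLt k}"
| "subformulae (Atom p) = {Atom p}"
| "subformulae (Not \<alpha>) = insert (Not \<alpha>) (subformulae \<alpha>)"
| "subformulae (Or \<alpha> \<beta>) = insert (Or \<alpha> \<beta>) (subformulae \<alpha> \<union> subformulae \<beta>)"
| "subformulae (DiaL \<alpha>) = insert (DiaL \<alpha>) (subformulae \<alpha>)"
| "subformulae (DiaR \<alpha>) = insert (DiaR \<alpha>) (subformulae \<alpha>)"

text \<open>
  Formulae are considered up to the congruence identifying \<open>\<not>\<not>\<alpha>\<close> with \<open>\<alpha>\<close>, each class being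
  represented by its unique member without double negations. As \<open>\<box>\<alpha>\<close> abbreviates \<open>\<not>\<diamond>\<not>\<alpha>\<close> and
  \<open>\<alpha> \<and> \<beta>\<close> abbreviates \<open>\<not>(\<not>\<alpha> \<or> \<not>\<beta>)\<close>, this includes the identification of \<open>\<not>\<diamond>\<alpha>\<close> with
  \<open>\<box>\<not>\<alpha>\<close> and of \<open>\<not>(\<alpha> \<or> \<beta>)\<close> with \<open>\<not>\<alpha> \<and> \<not>\<beta>\<close>. On representatives, \<open>neg\<close> is negation.
\<close>

fun neg :: "'p mpnl \<Rightarrow> 'p mpnl" where
  "neg (Not \<alpha>) = \<alpha>"
| "neg \<alpha> = Not \<alpha>"

fun norm_neg :: "'p mpnl \<Rightarrow> 'p mpnl" where
  "norm_neg (LenLt k) = LenLt k"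
| "norm_neg (Atom p) = Atom p"
| "norm_neg (Not \<alpha>) = neg (norm_neg \<alpha>)"
| "norm_neg (Or \<alpha> \<beta>) = Or (norm_neg \<alpha>) (norm_neg \<beta>)"
| "norm_neg (DiaL \<alpha>) = DiaL (norm_neg \<alpha>)"
| "norm_neg (DiaR \<alpha>) = DiaR (norm_neg \<alpha>)"

definition Cl :: "'p mpnl \<Rightarrow> 'p mpnl set" where
  "Cl \<phi> = norm_neg ` subformulae \<phi> \<union> neg ` norm_neg ` subformulae \<phi>"

definition atoms :: "'p mpnl \<Rightarrow> 'p mpnl set set" where
  "atoms \<phi> = {F. F \<noteq> {} \<and> F \<subseteq> Cl \<phi>
     \<and> (\<forall>\<alpha>\<in>Cl \<phi>. \<alpha> \<in> F \<longleftrightarrow> neg \<alpha> \<notin> F)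
     \<and> (\<forall>\<alpha> \<beta>. Or \<alpha> \<beta> \<in> Cl \<phi> \<longrightarrow> (Or \<alpha> \<beta> \<in> F \<longleftrightarrow> \<alpha> \<in> F \<or> \<beta> \<in> F))
     \<and> (\<forall>k k'. k < k' \<and> LenLt k \<in> F \<and> LenLt k' \<in> Cl \<phi> \<longrightarrow> LenLt k' \<in> F)}"

definition Obs_r :: "'p mpnl \<Rightarrow> 'p mpnl set \<Rightarrow> 'p mpnl set" where
  "Obs_r \<phi> F = {\<psi>\<in>F. DiaR \<psi> \<in> Cl \<phi>}"

definition Obs_l :: "'p mpnl \<Rightarrow> 'p mpnl set \<Rightarrow> 'p mpnl set" where
  "Obs_l \<phi> F = {\<psi>\<in>F. DiaL \<psi> \<in> Cl \<phi>}"

definition Req_r :: "'p mpnl set \<Rightarrow> 'p mpnl set" where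
  "Req_r F = {\<psi>. DiaR \<psi> \<in> F}"

definition Req_l :: "'p mpnl set \<Rightarrow> 'p mpnl set" where
  "Req_l F = {\<psi>. DiaL \<psi> \<in> F}"

definition atom_rel :: "'p mpnl \<Rightarrow> 'p mpnl set \<Rightarrow> 'p mpnl set \<Rightarrow> bool" where
  "atom_rel \<phi> F G \<longleftrightarrow> Obs_r \<phi> G \<subseteq> Req_r F \<and> Obs_l \<phi> F \<subseteq> Req_l G"

definition points :: "int set \<Rightarrow> (int \<times> int) set" where
  "points D = {(x, y). x \<in> D \<and> y \<in> D \<and> x \<le> y}"

text \<open>
  A compass structure is given by its domain \<open>D\<close> and a labelling; the values of the labelling
  outside \<open>points D\<close> are irrelevant.
\<close>

definition compass_structure ::
    "'p mpnl \<Rightarrow> int set \<Rightarrow> (int \<times> int \<Rightarrow> 'p mpnl set) \<Rightarrow> bool" where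
  "compass_structure \<phi> D L \<longleftrightarrow>
     (\<forall>q\<in>points D. L q \<in> atoms \<phi>)
     \<and> (\<forall>x y x' y'. (x, y) \<in> points D \<and> (x', y') \<in> points D \<and> y = x'
          \<longrightarrow> atom_rel \<phi> (L (x, y)) (L (x', y')))
     \<and> (\<forall>x y k. (x, y) \<in> points D \<and> LenLt k \<in> L (x, y) \<longrightarrow> y - x < int k)"

definition features ::
    "int set \<Rightarrow> (int \<times> int \<Rightarrow> 'p mpnl set) \<Rightarrow> 'p mpnl \<Rightarrow> bool" where
  "features D L \<psi> \<longleftrightarrow> (\<exists>q\<in>points D. norm_neg \<psi> \<in> L q)"

definition l_requests_fulfilled ::
    "int set \<Rightarrow> (int \<times> int \<Rightarrow> 'p mpnl set) \<Rightarrow> int \<times> int \<Rightarrow> bool" where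
  "l_requests_fulfilled D L q \<longleftrightarrow>
     (\<forall>\<psi>\<in>Req_l (L q). \<exists>x'. (x', fst q) \<in> points D \<and> \<psi> \<in> L (x', fst q))"

definition k_max :: "'p mpnl \<Rightarrow> nat" where
  "k_max \<phi> = Max (insert 0 {k. LenLt k \<in> subformulae \<phi>})"

type_synonym 'p marked_atom = "'p mpnl set \<times> 'p mpnl set \<times> nat"

definition marked_atoms :: "'p mpnl \<Rightarrow> 'p marked_atom set" where
  "marked_atoms \<phi> = atoms \<phi> \<times> Pow (Cl \<phi>) \<times> {0..k_max \<phi>}"

text \<open>
  \<open>marking\<close> is only meaningful at points \<open>(x, y)\<close> of a convex domain, where every integer
  \<open>y'\<close> with \<open>x \<le> y' \<le> y\<close> belongs to the domain.
\<close>

definition marking ::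
    "'p mpnl \<Rightarrow> (int \<times> int \<Rightarrow> 'p mpnl set) \<Rightarrow> int \<times> int \<Rightarrow> 'p marked_atom" where
  "marking \<phi> L = (\<lambda>(x, y).
     (L (x, y),
      {\<psi> \<in> Req_r (L (x, x)). \<forall>y'. x \<le> y' \<and> y' \<le> y \<longrightarrow> \<psi> \<notin> L (x, y')},
      min (nat (y - x)) (k_max \<phi>)))"

definition config ::
    "'p mpnl \<Rightarrow> int set \<Rightarrow> (int \<times> int \<Rightarrow> 'p mpnl set) \<Rightarrow> int \<Rightarrow> 'p marked_atom \<Rightarrow> nat" where
  "config \<phi> D L y m = card {x. (x, y) \<in> points D \<and> marking \<phi> L (x, y) = m}"

definition Z_compass_generator ::
    "'p mpnl \<Rightarrow> int set \<Rightarrow> (int \<times> int \<Rightarrow> 'p mpnl set) \<Rightarrow> bool" where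
  "Z_compass_generator \<phi> D L \<longleftrightarrow> compass_structure \<phi> D L \<and>
     (\<exists>y_min y_max y_past y_fut.
        D = {y_min..y_max} \<and> y_past \<in> D \<and> y_fut \<in> D
        \<and> y_past < 0 \<and> 0 < y_fut
        \<and> y_past - y_min \<ge> int (k_max \<phi>) \<and> y_max - y_fut \<ge> int (k_max \<phi>)
        \<and> (\<forall>y. y_past \<le> y \<and> y \<le> y_max \<longrightarrow> l_requests_fulfilled D L (y, y))
        \<and> (\<forall>m\<in>marked_atoms \<phi>. config \<phi> D L y_max m > 0 \<longrightarrow> config \<phi> D L y_fut m > 0)
        \<and> (\<forall>x. y_min \<le> x \<and> x \<le> y_fut \<longrightarrow> (\<exists>F h. marking \<phi> L (x, y_max) = (F, {}, h)))
        \<and> (\<forall>m\<in>marked_atoms \<phi>. config \<phi> D L y_past m > 0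
             \<longrightarrow> (\<exists>x. y_past \<le> x \<and> x \<le> 0 \<and> marking \<phi> L (x, 0) = m)))"

end

theory Submission
  imports Defs "HOL-Library.FuncSet"
begin

text \<open>
  Take a generator with the fewest rows among those whose centre \<open>z\<close> need not be \<open>0\<close>. If two rows
  \<open>u < v\<close> carry the same number of columns in each state, up to a threshold, and no distinguished row
  lies in \<open>{u<..v}\<close>, then the rows \<open>{u<..v}\<close> can be removed: above \<open>u\<close>, a column \<open>x \<le> u\<close> copies labels
  from columns \<open>x' \<le> v\<close> whose state at \<open>v\<close> is that of \<open>x\<close> at \<open>u\<close>. The copied column may change from
  row to row, since labels in the same column constrain each other only through the set of formulae
  seen in that column and through the pending requests. This freedom lets boundedly many columns
  per state provide the witnesses of the left requests of all rows above. By minimality, rows between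
  distinguished ones differ in their truncated state counts, of which there are
  at most \<open>(threshold \<phi> + 1) ^ card (states \<phi>)\<close>.
\<close>

section \<open>The closure of a formula\<close>

lemma norm_neg_not_double_neg: "norm_neg \<chi> \<noteq> Not (Not \<alpha>)"
proof (induction \<chi> arbitrary: \<alpha>)
  case (Not \<chi>)
  then show ?case by (cases "norm_neg \<chi>") auto
qed auto

lemma neg_norm_neg_eq_iff:
  assumes "\<And>\<gamma>. \<beta> \<noteq> Not \<gamma>"
  shows "neg (norm_neg \<chi>) = \<beta> \<longleftrightarrow> norm_neg \<chi> = Not \<beta>"
    and "neg (norm_neg \<chi>) = Not \<beta> \<longleftrightarrow> norm_neg \<chi> = \<beta>"
  using assms norm_neg_not_double_neg[of \<chi>] by (cases "norm_neg \<chi>"; auto)+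

text \<open>The induction needs both forms at once, since each \<open>Not\<close> that it passes
  exchanges \<open>DiaR \<psi>\<close> and \<open>Not (DiaR \<psi>)\<close>. The same applies to
  \<open>norm_neg_eq_DiaL\<close> and \<open>norm_neg_eq_LenLt\<close>.\<close>

lemma norm_neg_eq_DiaR:
  "norm_neg \<chi> = DiaR \<psi> \<or> norm_neg \<chi> = Not (DiaR \<psi>)
    \<Longrightarrow> \<exists>\<theta>. DiaR \<theta> \<in> subformulae \<chi> \<and> norm_neg \<theta> = \<psi>"
  by (induction \<chi>) (auto simp: neg_norm_neg_eq_iff)

lemma norm_neg_eq_DiaL:
  "norm_neg \<chi> = DiaL \<psi> \<or> norm_neg \<chi> = Not (DiaL \<psi>)
    \<Longrightarrow> \<exists>\<theta>. DiaL \<theta> \<in> subformulae \<chi> \<and> norm_neg \<theta> = \<psi>"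
  by (induction \<chi>) (auto simp: neg_norm_neg_eq_iff)

lemma norm_neg_eq_LenLt:
  "norm_neg \<chi> = LenLt j \<or> norm_neg \<chi> = Not (LenLt j) \<Longrightarrow> LenLt j \<in> subformulae \<chi>"
  by (induction \<chi>) (auto simp: neg_norm_neg_eq_iff)

lemma subformulae_refl: "\<chi> \<in> subformulae \<chi>"
  by (cases \<chi>) auto

lemma subformulae_trans: "\<theta> \<in> subformulae \<chi> \<Longrightarrow> \<chi> \<in> subformulae \<phi> \<Longrightarrow> \<theta> \<in> subformulae \<phi>"
  by (induction \<phi>) auto

lemma finite_subformulae: "finite (subformulae \<phi>)"
  by (induction \<phi>) auto

lemma finite_Cl: "finite (Cl \<phi>)"
  by (simp add: Cl_def finite_subformulae)

lemma Cl_E: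
  assumes "\<beta> \<in> Cl \<phi>" and "\<And>\<gamma>. \<beta> \<noteq> Not \<gamma>"
  obtains \<chi> where "\<chi> \<in> subformulae \<phi>" "norm_neg \<chi> = \<beta> \<or> norm_neg \<chi> = Not \<beta>"
proof -
  from assms(1) obtain \<chi> where "\<chi> \<in> subformulae \<phi>" "\<beta> = norm_neg \<chi> \<or> \<beta> = neg (norm_neg \<chi>)"
    unfolding Cl_def by blast
  then show thesis
    using that neg_norm_neg_eq_iff(1)[of \<beta> \<chi>] assms(2) by metis
qed

text \<open>\<open>Obs_r \<phi> F\<close> is \<open>F \<inter> right_args \<phi>\<close>, and
  \<open>Req_r\<close> of an atom is a subset of \<open>right_args \<phi>\<close>; likewise for
  \<open>left_args\<close>. Counting with these sets instead of \<open>Cl \<phi>\<close> keeps the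
  exponents small.\<close>

definition right_args :: "'p mpnl \<Rightarrow> 'p mpnl set" where
  "right_args \<phi> = {\<psi>. DiaR \<psi> \<in> Cl \<phi>}"

definition left_args :: "'p mpnl \<Rightarrow> 'p mpnl set" where
  "left_args \<phi> = {\<psi>. DiaL \<psi> \<in> Cl \<phi>}"

lemma right_args_subset: "right_args \<phi> \<subseteq> norm_neg ` {\<theta>. DiaR \<theta> \<in> subformulae \<phi>}"
proof
  fix \<psi> assume "\<psi> \<in> right_args \<phi>"
  then obtain \<chi> where \<chi>: "\<chi> \<in> subformulae \<phi>"
      and "norm_neg \<chi> = DiaR \<psi> \<or> norm_neg \<chi> = Not (DiaR \<psi>)"
    unfolding right_args_def by (blast elim: Cl_E)
  then show "\<psi> \<in> norm_neg ` {\<theta>. DiaR \<theta> \<in> subformulae \<phi>}"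
    using norm_neg_eq_DiaR[of \<chi> \<psi>] subformulae_trans[OF _ \<chi>] by blast
qed

lemma left_args_subset: "left_args \<phi> \<subseteq> norm_neg ` {\<theta>. DiaL \<theta> \<in> subformulae \<phi>}"
proof
  fix \<psi> assume "\<psi> \<in> left_args \<phi>"
  then obtain \<chi> where \<chi>: "\<chi> \<in> subformulae \<phi>"
      and "norm_neg \<chi> = DiaL \<psi> \<or> norm_neg \<chi> = Not (DiaL \<psi>)"
    unfolding left_args_def by (blast elim: Cl_E)
  then show "\<psi> \<in> norm_neg ` {\<theta>. DiaL \<theta> \<in> subformulae \<phi>}"
    using norm_neg_eq_DiaL[of \<chi> \<psi>] subformulae_trans[OF _ \<chi>] by blast
qed

lemma right_args_subset_Cl: "right_args \<phi> \<subseteq> Cl \<phi>"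
proof -
  have "\<theta> \<in> subformulae \<phi>" if "DiaR \<theta> \<in> subformulae \<phi>" for \<theta>
    using that subformulae_trans[of \<theta> "DiaR \<theta>" \<phi>] by (simp add: subformulae_refl)
  then show ?thesis using right_args_subset[of \<phi>] unfolding Cl_def by blast
qed

lemma finite_diamonds:
  "finite {\<theta>. DiaR \<theta> \<in> subformulae \<phi>}" "finite {\<theta>. DiaL \<theta> \<in> subformulae \<phi>}"
  using finite_vimageI[OF finite_subformulae, of DiaR \<phi>] finite_vimageI[OF finite_subformulae, of DiaL \<phi>]
  by (simp_all add: inj_def vimage_def)

lemma finite_left_args: "finite (left_args \<phi>)"
  using finite_subset[OF left_args_subset] finite_diamonds(2)[of \<phi>] by blast

lemma finite_right_args: "finite (right_args \<phi>)"
  using finite_subset[OF right_args_subset_Cl finite_Cl] .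

lemma finite_lengths: "finite {k. LenLt k \<in> subformulae \<phi>}"
  using finite_vimageI[OF finite_subformulae, of LenLt] by (simp add: inj_def vimage_def)

lemma LenLt_Cl_le_k_max:
  assumes "LenLt j \<in> Cl \<phi>"
  shows "j \<le> k_max \<phi>"
proof -
  obtain \<chi> where "\<chi> \<in> subformulae \<phi>" "norm_neg \<chi> = LenLt j \<or> norm_neg \<chi> = Not (LenLt j)"
    using assms by (blast elim: Cl_E)
  then have "LenLt j \<in> subformulae \<phi>"
    using norm_neg_eq_LenLt subformulae_trans by blast
  then show ?thesis
    unfolding k_max_def using finite_lengths by (auto intro!: Max_ge)
qed

section \<open>Counting\<close>

lemma k_max_simps:
  "k_max (LenLt k) = k" "k_max (Atom p) = 0" "k_max (Not \<alpha>) = k_max \<alpha>"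
  "k_max (Or \<alpha> \<beta>) = max (k_max \<alpha>) (k_max \<beta>)"
  "k_max (DiaL \<alpha>) = k_max \<alpha>" "k_max (DiaR \<alpha>) = k_max \<alpha>"
proof -
  show "k_max (Or \<alpha> \<beta>) = max (k_max \<alpha>) (k_max \<beta>)"
  proof -
    have "insert 0 {k. LenLt k \<in> subformulae (Or \<alpha> \<beta>)} =
        insert 0 {k. LenLt k \<in> subformulae \<alpha>} \<union> insert 0 {k. LenLt k \<in> subformulae \<beta>}"
      by auto
    then show ?thesis
      unfolding k_max_def by (simp only: Max_Un finite_insert finite_lengths insert_not_empty not_False_eq_True)
  qed
qed (simp_all add: k_max_def)

lemma floorlog_max_le: "floorlog b (max k j) \<le> floorlog b k + floorlog b j"
  by (simp add: max_def)

text \<open>Each subformula is charged to its leading symbol; the binary digits of the constants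
  remain and pay for those of \<open>k_max \<phi>\<close>.\<close>

lemma card_subformulae_le: "card (subformulae \<phi>) + floorlog 2 (k_max \<phi>) \<le> mpnl_length \<phi>"
proof (induction \<phi>)
  case (Or \<alpha> \<beta>)
  have "card (subformulae (Or \<alpha> \<beta>)) \<le> 1 + (card (subformulae \<alpha>) + card (subformulae \<beta>))"
    using card_Un_le[of "subformulae \<alpha>" "subformulae \<beta>"]
    by (simp add: card_insert_if finite_subformulae)
  then show ?case
    using Or floorlog_max_le[of 2 "k_max \<alpha>" "k_max \<beta>"] by (simp add: k_max_simps)
qed (auto simp: k_max_simps card_insert_if finite_subformulae floorlog_def)

text \<open>The summand 1 is the symbol of a leaf, which is not a diamond.\<close>

lemma card_diamonds_le:
  "card {\<theta>. DiaR \<theta> \<in> subformulae \<phi>} + card {\<theta>. DiaL \<theta> \<in> subformulae \<phi>}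
     + floorlog 2 (k_max \<phi>) + 1 \<le> mpnl_length \<phi>"
proof (induction \<phi>)
  case (Or \<alpha> \<beta>)
  have "card {\<theta>. DiaR \<theta> \<in> subformulae (Or \<alpha> \<beta>)}
      \<le> card {\<theta>. DiaR \<theta> \<in> subformulae \<alpha>} + card {\<theta>. DiaR \<theta> \<in> subformulae \<beta>}"
    using card_Un_le[of "{\<theta>. DiaR \<theta> \<in> subformulae \<alpha>}" "{\<theta>. DiaR \<theta> \<in> subformulae \<beta>}"]
    by (simp add: Un_def)
  moreover have "card {\<theta>. DiaL \<theta> \<in> subformulae (Or \<alpha> \<beta>)}
      \<le> card {\<theta>. DiaL \<theta> \<in> subformulae \<alpha>} + card {\<theta>. DiaL \<theta> \<in> subformulae \<beta>}"
    using card_Un_le[of "{\<theta>. DiaL \<theta> \<in> subformulae \<alpha>}" "{\<theta>. DiaL \<theta> \<in> subformulae \<beta>}"]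
    by (simp add: Un_def)
  ultimately show ?case
    using Or floorlog_max_le[of 2 "k_max \<alpha>" "k_max \<beta>"] by (simp add: k_max_simps)
next
  case (DiaL \<alpha>)
  have "{\<theta>. DiaL \<theta> \<in> subformulae (DiaL \<alpha>)} = insert \<alpha> {\<theta>. DiaL \<theta> \<in> subformulae \<alpha>}" by auto
  then show ?case using DiaL finite_diamonds(2)[of \<alpha>] by (auto simp: k_max_simps card_insert_if)
next
  case (DiaR \<alpha>)
  have "{\<theta>. DiaR \<theta> \<in> subformulae (DiaR \<alpha>)} = insert \<alpha> {\<theta>. DiaR \<theta> \<in> subformulae \<alpha>}" by auto
  then show ?case using DiaR finite_diamonds(1)[of \<alpha>] by (auto simp: k_max_simps card_insert_if)
qed (auto simp: k_max_simps floorlog_def)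

lemma card_args_le:
  "card (right_args \<phi>) + card (left_args \<phi>) + floorlog 2 (k_max \<phi>) + 1 \<le> mpnl_length \<phi>"
  using card_diamonds_le[of \<phi>] surj_card_le[OF finite_diamonds(1) right_args_subset[of \<phi>]]
    surj_card_le[OF finite_diamonds(2) left_args_subset[of \<phi>]]
  by linarith

lemma k_max_less: "k_max \<phi> + 1 \<le> 2 ^ floorlog 2 (k_max \<phi>)"
  using floorlog_bounds[of "k_max \<phi>" 2] by (cases "k_max \<phi> = 0") (auto simp: floorlog_def)

section \<open>The number of atoms\<close>

lemma neg_in_atom_iff: "F \<in> atoms \<phi> \<Longrightarrow> \<beta> \<in> Cl \<phi> \<Longrightarrow> neg \<beta> \<in> F \<longleftrightarrow> \<beta> \<notin> F"
  by (simp add: atoms_def)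

lemma atom_subset_Cl: "F \<in> atoms \<phi> \<Longrightarrow> F \<subseteq> Cl \<phi>"
  by (simp add: atoms_def)

text \<open>An atom is determined by the normalised subformulae that it contains, because the other
  members of the closure are negations of these.\<close>

lemma card_atoms_le: "finite (atoms \<phi>)" "card (atoms \<phi>) \<le> 2 ^ card (subformulae \<phi>)"
proof -
  let ?N = "norm_neg ` subformulae \<phi>"
  show "finite (atoms \<phi>)"
    by (rule finite_subset[of _ "Pow (Cl \<phi>)"]) (use atom_subset_Cl finite_Cl in auto)
  have "inj_on (\<lambda>F. F \<inter> ?N) (atoms \<phi>)"
  proof (rule inj_onI)
    fix F G assume F: "F \<in> atoms \<phi>" and G: "G \<in> atoms \<phi>" and eq: "F \<inter> ?N = G \<inter> ?N"
    have "\<alpha> \<in> F \<longleftrightarrow> \<alpha> \<in> G" if \<alpha>: "\<alpha> \<in> Cl \<phi>" for \<alpha>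
    proof (cases "\<alpha> \<in> ?N")
      case True then show ?thesis using eq by blast
    next
      case False
      then obtain \<beta> where "\<beta> \<in> ?N" "\<alpha> = neg \<beta>" using \<alpha> by (auto simp: Cl_def)
      moreover have "\<beta> \<in> Cl \<phi>" using \<open>\<beta> \<in> ?N\<close> by (simp add: Cl_def)
      ultimately show ?thesis using neg_in_atom_iff[OF F] neg_in_atom_iff[OF G] eq by blast
    qed
    then show "F = G" using atom_subset_Cl[OF F] atom_subset_Cl[OF G] by blast
  qed
  moreover have "(\<lambda>F. F \<inter> ?N) ` atoms \<phi> \<subseteq> Pow ?N" by auto
  ultimately have "card (atoms \<phi>) \<le> card (Pow ?N)"
    by (rule card_inj_on_le) (simp add: finite_subformulae)
  also have "\<dots> \<le> 2 ^ card (subformulae \<phi>)"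
    by (simp add: card_Pow finite_subformulae card_image_le)
  finally show "card (atoms \<phi>) \<le> 2 ^ card (subformulae \<phi>)" .
qed

section \<open>Generators with an arbitrary centre\<close>

definition pending :: "(int \<times> int \<Rightarrow> 'p mpnl set) \<Rightarrow> int \<Rightarrow> int \<Rightarrow> 'p mpnl set" where
  "pending L x y = {\<psi> \<in> Req_r (L (x, x)). \<forall>y'. x \<le> y' \<and> y' \<le> y \<longrightarrow> \<psi> \<notin> L (x, y')}"

lemma marking_eq: "marking \<phi> L (x, y) = (L (x, y), pending L x y, min (nat (y - x)) (k_max \<phi>))"
  by (simp add: marking_def pending_def)

lemma pending_split:
  assumes "x \<le> v" "v \<le> w"
  shows "pending L x w = {\<psi> \<in> pending L x v. \<forall>B. v < B \<and> B \<le> w \<longrightarrow> \<psi> \<notin> L (x, B)}"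
proof -
  have "(\<forall>y'. x \<le> y' \<and> y' \<le> w \<longrightarrow> P y') \<longleftrightarrow>
      (\<forall>y'. x \<le> y' \<and> y' \<le> v \<longrightarrow> P y') \<and> (\<forall>B. v < B \<and> B \<le> w \<longrightarrow> P B)" for P
    using assms by (meson dual_order.trans le_less_linear less_imp_le)
  then show ?thesis unfolding pending_def by auto
qed

text \<open>All markings in a generator lie in this set, which is smaller than
  \<open>marked_atoms \<phi>\<close>: requests at a diagonal point are right arguments.\<close>

definition column_marks :: "'p mpnl \<Rightarrow> 'p marked_atom set" where
  "column_marks \<phi> = atoms \<phi> \<times> Pow (right_args \<phi>) \<times> {0..k_max \<phi>}"

text \<open>The letters \<open>a\<close>, \<open>e\<close>, \<open>p\<close>, \<open>f\<close> stand
  for y_min, y_max, y_past, y_fut, and \<open>z\<close> takes the role of 0. The centre is free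
  because removing rows below it while keeping \<open>a\<close> moves it. Configurations occur only
  through their positivity, hence as existence of columns.\<close>

locale centred_generator =
  fixes \<phi> :: "'p mpnl" and L :: "int \<times> int \<Rightarrow> 'p mpnl set" and a e p z f :: int
  assumes atom: "a \<le> x \<Longrightarrow> x \<le> y \<Longrightarrow> y \<le> e \<Longrightarrow> L (x, y) \<in> atoms \<phi>"
    and rel: "a \<le> x \<Longrightarrow> x \<le> y \<Longrightarrow> y \<le> w \<Longrightarrow> w \<le> e \<Longrightarrow> atom_rel \<phi> (L (x, y)) (L (y, w))"
    and len: "a \<le> x \<Longrightarrow> x \<le> y \<Longrightarrow> y \<le> e \<Longrightarrow> LenLt j \<in> L (x, y) \<Longrightarrow> y - x < int j"
    and bounds: "a + int (k_max \<phi>) \<le> p" "p < z" "z < f" "f + int (k_max \<phi>) \<le> e"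
    and left_fulfilled: "p \<le> y \<Longrightarrow> y \<le> e \<Longrightarrow> \<psi> \<in> Req_l (L (y, y))
      \<Longrightarrow> \<exists>x. a \<le> x \<and> x \<le> y \<and> \<psi> \<in> L (x, y)"
    and future: "a \<le> x \<Longrightarrow> x \<le> e
      \<Longrightarrow> \<exists>x'. a \<le> x' \<and> x' \<le> f \<and> marking \<phi> L (x', f) = marking \<phi> L (x, e)"
    and right_fulfilled: "a \<le> x \<Longrightarrow> x \<le> f \<Longrightarrow> pending L x e = {}"
    and past: "a \<le> x \<Longrightarrow> x \<le> p
      \<Longrightarrow> \<exists>x'. p \<le> x' \<and> x' \<le> z \<and> marking \<phi> L (x', z) = marking \<phi> L (x, p)"
    and featured: "\<exists>x y. a \<le> x \<and> x \<le> y \<and> y \<le> e \<and> norm_neg \<phi> \<in> L (x, y)"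
begin

definition seen_right :: "int \<Rightarrow> 'p mpnl set" where
  "seen_right x = {\<psi> \<in> right_args \<phi>. \<exists>c. x \<le> c \<and> c \<le> e \<and> \<psi> \<in> L (x, c)}"

definition seen_left :: "int \<Rightarrow> 'p mpnl set" where
  "seen_left x = {\<psi> \<in> left_args \<phi>. \<exists>w. a \<le> w \<and> w \<le> x \<and> \<psi> \<in> L (w, x)}"

text \<open>
  Off the diagonal, labels may contain requests that are never fulfilled, so the marking at \<open>(x, y)\<close>
  does not determine which labels column \<open>x\<close> tolerates above \<open>y\<close>; \<open>seen_right\<close> and \<open>seen_left\<close> do.
  The flag \<open>p \<le> x\<close> keeps the witnesses for \<open>past\<close> to the right of \<open>p\<close>. By \<open>pending_end\<close> below, the state
  at any row determines \<open>pending L x e\<close>.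
\<close>

definition state :: "int \<Rightarrow> int \<Rightarrow> 'p mpnl set \<times> 'p mpnl set \<times> 'p mpnl set \<times> nat \<times> bool" where
  "state x y = (seen_right x, pending L x y, seen_left x, min (nat (y - x)) (k_max \<phi>), p \<le> x)"

text \<open>
  The rows at which a column that follows \<open>t\<close> may not be relabelled: rows whose marking has to be
  reproduced, and the at most \<open>card (right_args \<phi>)\<close> rows at which \<open>t\<close> fulfils one of its requests.
\<close>

definition busy :: "int \<Rightarrow> int \<Rightarrow> bool" where
  "busy t B \<longleftrightarrow> B \<le> p \<or> B = e \<or> L (t, B) \<inter> pending L t (B - 1) \<noteq> {}"

lemma pending_subset:
  assumes "a \<le> x" "x \<le> e"
  shows "pending L x y \<subseteq> right_args \<phi>"
  using atom_subset_Cl[OF atom[OF assms(1) order_refl assms(2)]]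
  unfolding pending_def Req_r_def right_args_def by blast

lemma marking_in_column_marks:
  assumes "a \<le> x" "x \<le> y" "y \<le> e"
  shows "marking \<phi> L (x, y) \<in> column_marks \<phi>"
  using assms atom[OF assms] pending_subset[of x y]
  unfolding marking_eq column_marks_def by auto

text \<open>A request pending at \<open>w\<close> has not been met up to \<open>w\<close>, so it is
  seen in the column exactly if it is met above \<open>w\<close>.\<close>

lemma pending_end:
  assumes "a \<le> x" "x \<le> w" "w \<le> e"
  shows "pending L x e = pending L x w - seen_right x"
proof (intro equalityI subsetI)
  fix \<psi> assume "\<psi> \<in> pending L x e"
  then show "\<psi> \<in> pending L x w - seen_right x"
    using assms unfolding pending_def seen_right_def by auto
next
  fix \<psi> assume \<psi>: "\<psi> \<in> pending L x w - seen_right x"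
  then have "\<psi> \<in> right_args \<phi>" using pending_subset[of x w] assms by auto
  then show "\<psi> \<in> pending L x e"
    using \<psi> unfolding pending_def seen_right_def by auto
qed

text \<open>By this and the next three lemmas, \<open>atom_rel\<close> between \<open>(x, y)\<close>
  and \<open>(y, w)\<close> factors through \<open>seen_right y\<close> and
  \<open>seen_left y\<close>. Hence the label of \<open>(y, w)\<close> may be replaced by one from a
  column with the same two sets.\<close>

lemma Obs_r_subset_seen: "x \<le> y \<Longrightarrow> y \<le> e \<Longrightarrow> Obs_r \<phi> (L (x, y)) \<subseteq> seen_right x"
  unfolding Obs_r_def seen_right_def right_args_def by blast

lemma Obs_l_subset_seen: "a \<le> x \<Longrightarrow> x \<le> y \<Longrightarrow> Obs_l \<phi> (L (x, y)) \<subseteq> seen_left y"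
  unfolding Obs_l_def seen_left_def left_args_def by blast

lemma seen_right_subset_Req:
  assumes "a \<le> x" "x \<le> y"
  shows "seen_right y \<subseteq> Req_r (L (x, y))"
  using assms rel[of x y] unfolding seen_right_def right_args_def atom_rel_def Obs_r_def by blast

lemma seen_left_subset_Req:
  assumes "y \<le> w" "w \<le> e"
  shows "seen_left y \<subseteq> Req_l (L (y, w))"
  using assms rel[of _ y w] unfolding seen_left_def left_args_def atom_rel_def Obs_l_def by blast

text \<open>Each right argument accounts for at most one row, the first at which \<open>t\<close>
  fulfils it; the other two rows are \<open>p\<close> and \<open>e\<close>. All rows below
  \<open>p\<close> are busy and therefore left out of the count.\<close>

lemma busy_rows:
  assumes "a \<le> t" "t \<le> v" "v < e"
  shows "finite {B. v < B \<and> p \<le> B \<and> busy t B}"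
    and "card {B. v < B \<and> p \<le> B \<and> busy t B} \<le> card (right_args \<phi>) + 2"
proof -
  let ?P = "\<lambda>\<psi> B. t \<le> B \<and> \<psi> \<in> L (t, B) \<and> \<psi> \<in> pending L t (B - 1)"
  have uniq: "B = B'" if "?P \<psi> B" "?P \<psi> B'" for \<psi> B B'
  proof (rule ccontr)
    assume "B \<noteq> B'"
    then have "B \<le> B' - 1 \<or> B' \<le> B - 1" by linarith
    then show False using that unfolding pending_def by blast
  qed
  \<comment> \<open>For an argument that is never fulfilled above \<open>t\<close>,
    \<open>THE\<close> yields some unspecified row, which can only enlarge the covering set.\<close>
  have sub: "{B. v < B \<and> p \<le> B \<and> busy t B} \<subseteq> {p, e} \<union> (\<lambda>\<psi>. THE B. ?P \<psi> B) ` right_args \<phi>"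
  proof
    fix B assume B: "B \<in> {B. v < B \<and> p \<le> B \<and> busy t B}"
    show "B \<in> {p, e} \<union> (\<lambda>\<psi>. THE B. ?P \<psi> B) ` right_args \<phi>"
    proof (cases "B = p \<or> B = e")
      case False
      then obtain \<psi> where "\<psi> \<in> L (t, B)" "\<psi> \<in> pending L t (B - 1)"
        using B unfolding busy_def by auto
      then have P: "?P \<psi> B" using B assms by auto
      then have "B = (THE B. ?P \<psi> B)" by (intro the_equality[symmetric]) (use uniq in blast)+
      moreover have "\<psi> \<in> right_args \<phi>" using P pending_subset[of t "B - 1"] assms by auto
      ultimately show ?thesis by (intro UnI2 image_eqI)
    qed auto
  qed
  have fin: "finite ({p, e} \<union> (\<lambda>\<psi>. THE B. ?P \<psi> B) ` right_args \<phi>)"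
    by (simp add: finite_right_args)
  show "finite {B. v < B \<and> p \<le> B \<and> busy t B}"
    using finite_subset[OF sub fin] .
  have "card {B. v < B \<and> p \<le> B \<and> busy t B} \<le> card ({p, e} \<union> (\<lambda>\<psi>. THE B. ?P \<psi> B) ` right_args \<phi>)"
    by (rule card_mono[OF fin sub])
  also have "\<dots> \<le> card {p, e} + card ((\<lambda>\<psi>. THE B. ?P \<psi> B) ` right_args \<phi>)"
    by (rule card_Un_le)
  also have "\<dots> \<le> 2 + card (right_args \<phi>)"
    by (intro add_mono card_image_le finite_right_args) (simp add: card_insert_if)
  finally show "card {B. v < B \<and> p \<le> B \<and> busy t B} \<le> card (right_args \<phi>) + 2" by simp
qed

text \<open>
  \<open>X\<close> and \<open>Y\<close> are the columns of one state at the lower and at the upper row. If \<open>Y\<close> is large, one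
  column \<open>t0\<close> of it is followed by default. One column of \<open>X\<close> per left argument \<open>\<psi>\<close> copies, at every
  row where \<open>t0\<close> is not busy, a witness of \<open>\<psi>\<close>; the witnesses at the few busy rows, like the members
  of \<open>Key\<close>, are followed for good by columns of their own.
\<close>

lemma class_assignment:
  fixes X Y Key :: "int set"
  assumes fin: "finite X" "finite Y"
    and cards: "card X = card Y \<or> T \<le> card X \<and> T \<le> card Y" and "0 < T"
    and Y: "Y \<subseteq> {a..v}" and "v < e" and Key: "Key \<subseteq> Y"
    and T: "card Key + card (left_args \<phi>) * (card (right_args \<phi>) + 3) \<le> T"
  shows "\<exists>g t. (\<forall>x\<in>X. t x \<in> Y \<and> (\<forall>B. g x B \<in> Y \<and> (busy (t x) B \<longrightarrow> g x B = t x)))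
    \<and> (\<forall>\<kappa>\<in>Key. \<exists>x\<in>X. \<forall>B. g x B = \<kappa>)
    \<and> (\<forall>B \<psi>. v < B \<and> p \<le> B \<and> \<psi> \<in> left_args \<phi> \<and> (\<exists>y\<in>Y. \<psi> \<in> L (y, B))
          \<longrightarrow> (\<exists>x\<in>X. \<psi> \<in> L (g x B, B)))"
proof (cases "card X = card Y")
  case True
  then obtain b where b: "bij_betw b X Y" using finite_same_card_bij[OF fin] by blast
  \<comment> \<open>With equally many columns on both sides, each column follows its partner at all
    rows.\<close>
  show ?thesis
    by (rule exI[of _ "\<lambda>x B. b x"], rule exI[of _ b])
      (use b Key in \<open>auto simp: bij_betw_def\<close>)
next
  case False
  then have XT: "T \<le> card X" and "T \<le> card Y" using cards by auto
  then obtain t0 where t0: "t0 \<in> Y" using \<open>0 < T\<close> fin(2)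
    by (metis all_not_in_conv card.empty leD)
  \<comment> \<open>Witnesses are wanted only from \<open>p\<close> on, so the busy rows below
    \<open>p\<close>, whose number is not bounded, do not enter.\<close>
  define Bs where "Bs = {B. v < B \<and> p \<le> B \<and> busy t0 B}"
  have Bs: "finite Bs" "card Bs \<le> card (right_args \<phi>) + 2"
    using busy_rows[of t0 v] t0 Y \<open>v < e\<close> unfolding Bs_def by auto
  \<comment> \<open>The default \<open>t0\<close> keeps \<open>wit B \<psi>\<close> inside
    \<open>Y\<close> even if no witness exists.\<close>
  define wit where "wit B \<psi> = (if \<exists>y\<in>Y. \<psi> \<in> L (y, B) then SOME y. y \<in> Y \<and> \<psi> \<in> L (y, B) else t0)" for B \<psi>
  have wit_Y: "wit B \<psi> \<in> Y" for B \<psi>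
    unfolding wit_def using t0 by (auto intro: someI2_ex)
  have wit_L: "\<psi> \<in> L (wit B \<psi>, B)" if "\<exists>y\<in>Y. \<psi> \<in> L (y, B)" for B \<psi>
    using that unfolding wit_def by (auto intro: someI2_ex)
  define K where "K = Key \<union> (\<lambda>(B, \<psi>). wit B \<psi>) ` (Bs \<times> left_args \<phi>)"
  have KY: "K \<subseteq> Y" unfolding K_def using Key wit_Y by auto
  have "card K \<le> card Key + card ((\<lambda>(B, \<psi>). wit B \<psi>) ` (Bs \<times> left_args \<phi>))"
    unfolding K_def by (rule card_Un_le)
  also have "\<dots> \<le> card Key + card Bs * card (left_args \<phi>)"
    using card_image_le[of "Bs \<times> left_args \<phi>" "\<lambda>(B, \<psi>). wit B \<psi>"] Bs(1) finite_left_args[of \<phi>]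
    by (simp add: card_cartesian_product)
  also have "\<dots> \<le> card Key + (card (right_args \<phi>) + 2) * card (left_args \<phi>)"
    by (intro add_left_mono mult_right_mono Bs(2)) simp
  \<comment> \<open>Of the \<open>card (right_args \<phi>) + 3\<close> columns per left argument,
    all but one follow witnesses at busy rows; the last relays witnesses at the remaining
    rows.\<close>
  finally have "card K + card (left_args \<phi>) \<le> T" using T by (simp add: algebra_simps)
  \<comment> \<open>The disjoint sum reserves separate columns of \<open>X\<close> for the followed
    columns and for the relays.\<close>
  then have "card (K <+> left_args \<phi>) \<le> card X"
    using XT finite_subset[OF KY fin(2)] finite_left_args[of \<phi>] by (simp add: card_Plus)
  then obtain h where h: "inj_on h (K <+> left_args \<phi>)" "h ` (K <+> left_args \<phi>) \<subseteq> X"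
    using inj_on_iff_card_le[of "K <+> left_args \<phi>" X] fin finite_subset[OF KY fin(2)] finite_left_args[of \<phi>]
    by auto
  define q where "q = the_inv_into (K <+> left_args \<phi>) h"
  have q: "q (h s) = s" if "s \<in> K <+> left_args \<phi>" for s
    unfolding q_def using the_inv_into_f_f[OF h(1) that] .
  define g where "g x B = (if x \<in> h ` (K <+> left_args \<phi>)
      then (case q x of Inl \<kappa> \<Rightarrow> \<kappa> | Inr \<psi> \<Rightarrow> if busy t0 B then t0 else wit B \<psi>) else t0)" for x B
  define t where "t x = (if x \<in> h ` (K <+> left_args \<phi>)
      then (case q x of Inl \<kappa> \<Rightarrow> \<kappa> | Inr \<psi> \<Rightarrow> t0) else t0)" for x
  have gK: "g (h (Inl \<kappa>)) B = \<kappa>" "h (Inl \<kappa>) \<in> X" if "\<kappa> \<in> K" for \<kappa> B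
    using q[OF InlI[OF that, of "left_args \<phi>"]] imageI[OF InlI[OF that, of "left_args \<phi>"], of h] h(2)
    unfolding g_def by (simp_all add: subsetD)
  have gS: "g (h (Inr \<psi>)) B = wit B \<psi>" "h (Inr \<psi>) \<in> X" if "\<psi> \<in> left_args \<phi>" "\<not> busy t0 B" for \<psi> B
    using q[OF InrI[OF that(1), of K]] imageI[OF InrI[OF that(1), of K], of h] h(2) that(2)
    unfolding g_def by (simp_all add: subsetD)
  have 1: "t x \<in> Y \<and> (\<forall>B. g x B \<in> Y \<and> (busy (t x) B \<longrightarrow> g x B = t x))" for x
  proof (cases "x \<in> h ` (K <+> left_args \<phi>)")
    case True
    then obtain s where s: "s \<in> K <+> left_args \<phi>" "x = h s" by blast
    then have qx: "q x = s" using q by simp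
    from s(1) show ?thesis
    proof
      fix \<kappa> assume "\<kappa> \<in> K" "s = Inl \<kappa>"
      then show ?thesis using True qx KY unfolding g_def t_def by auto
    next
      fix \<psi> assume "s = Inr \<psi>"
      then show ?thesis using True qx t0 wit_Y unfolding g_def t_def by auto
    qed
  next
    case False then show ?thesis using t0 unfolding g_def t_def by auto
  qed
  have 2: "\<exists>x\<in>X. \<forall>B. g x B = \<kappa>" if "\<kappa> \<in> Key" for \<kappa>
    using gK[of \<kappa>] that unfolding K_def by blast
  have 3: "\<exists>x\<in>X. \<psi> \<in> L (g x B, B)"
    if B: "v < B" "p \<le> B" "\<psi> \<in> left_args \<phi>" "\<exists>y\<in>Y. \<psi> \<in> L (y, B)" for B \<psi>
  proof (cases "busy t0 B")
    case True
    then have "wit B \<psi> \<in> K" using B unfolding K_def Bs_def by force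
    then show ?thesis using gK wit_L[OF B(4)] by metis
  next
    case False
    then show ?thesis using gS[OF B(3)] wit_L[OF B(4)] by metis
  qed
  from 1 2 3 show ?thesis by blast
qed

end

section \<open>Removing the rows between two rows with the same states\<close>

text \<open>Rows \<open>B\<close> are numbered as before the removal: \<open>g x B\<close> is the
  column that \<open>x\<close> copies at row \<open>B\<close>, and \<open>t x\<close> the column
  that it follows at busy rows. The margins \<open>k_max \<phi>\<close> in \<open>p_kept\<close> and
  \<open>f_kept\<close> preserve the required distances of \<open>p\<close> from \<open>a\<close>
  and of \<open>f\<close> from \<open>e\<close>. The members of \<open>Key\<close> are followed
  permanently, so that their markings survive.\<close>

locale contraction_map = centred_generator +
  fixes u v :: int and g :: "int \<Rightarrow> int \<Rightarrow> int" and t :: "int \<Rightarrow> int" and Key :: "int set"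
  assumes uv: "a \<le> u" "u < v" "v < e"
    and p_kept: "p \<le> u \<or> v + int (k_max \<phi>) < p"
    and z_kept: "z \<le> u \<or> v < z"
    and f_kept: "f + int (k_max \<phi>) \<le> u \<or> v < f"
    and t_state: "a \<le> x \<Longrightarrow> x \<le> u \<Longrightarrow> a \<le> t x \<and> t x \<le> v \<and> state (t x) v = state x u"
    and g_state: "a \<le> x \<Longrightarrow> x \<le> u \<Longrightarrow> a \<le> g x B \<and> g x B \<le> v \<and> state (g x B) v = state x u"
    and g_busy: "a \<le> x \<Longrightarrow> x \<le> u \<Longrightarrow> busy (t x) B \<Longrightarrow> g x B = t x"
    and Key_tracked: "\<kappa> \<in> Key \<Longrightarrow> \<kappa> \<le> v
      \<and> (\<exists>x. a \<le> x \<and> x \<le> u \<and> state x u = state \<kappa> v \<and> (\<forall>B. g x B = \<kappa>))"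
    and witness: "v < B \<Longrightarrow> p \<le> B \<Longrightarrow> \<psi> \<in> left_args \<phi> \<Longrightarrow> a \<le> y \<Longrightarrow> y \<le> v
      \<Longrightarrow> \<psi> \<in> L (y, B) \<Longrightarrow> \<exists>x. a \<le> x \<and> x \<le> u \<and> \<psi> \<in> L (g x B, B)"
    and Key_featured: "\<exists>x y. a \<le> x \<and> x \<le> y \<and> y \<le> e \<and> norm_neg \<phi> \<in> L (x, y)
      \<and> (y \<le> u \<or> v < y \<and> (v < x \<or> x \<in> Key))"
    and Key_future: "a \<le> x \<Longrightarrow> x \<le> e \<Longrightarrow>
      \<exists>x'. a \<le> x' \<and> x' \<le> f \<and> marking \<phi> L (x', f) = marking \<phi> L (x, e) \<and> (v < x' \<or> x' \<in> Key)"
    and Key_past: "a \<le> x \<Longrightarrow> x \<le> p \<Longrightarrow>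
      \<exists>x'. p \<le> x' \<and> x' \<le> z \<and> marking \<phi> L (x', z) = marking \<phi> L (x, p) \<and> (v < x' \<or> x' \<in> Key)"
begin

section \<open>The contracted labelling and its markings\<close>

definition d :: int where "d = v - u"

text \<open>The new number of a row that is kept; it is applied only to \<open>p\<close>,
  \<open>z\<close> and \<open>f\<close>, which lie outside \<open>{u<..v}\<close>.\<close>

definition shift :: "int \<Rightarrow> int" where "shift y = (if y \<le> u then y else y - d)"

definition contracted :: "int \<times> int \<Rightarrow> 'a mpnl set" where
  "contracted = (\<lambda>(x, y). if y \<le> u then L (x, y)
     else if x \<le> u then L (g x (y + d), y + d) else L (x + d, y + d))"

lemma contracted_low: "y \<le> u \<Longrightarrow> contracted (x, y) = L (x, y)"
  and contracted_cross: "x \<le> u \<Longrightarrow> u < y \<Longrightarrow> contracted (x, y) = L (g x (y + d), y + d)"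
  and contracted_high: "u < x \<Longrightarrow> x \<le> y \<Longrightarrow> contracted (x, y) = L (x + d, y + d)"
  by (auto simp: contracted_def)

lemma pending_low: "x \<le> y \<Longrightarrow> y \<le> u \<Longrightarrow> pending contracted x y = pending L x y"
  by (auto simp: pending_def contracted_low)

lemma marking_low: "x \<le> y \<Longrightarrow> y \<le> u \<Longrightarrow> marking \<phi> contracted (x, y) = marking \<phi> L (x, y)"
  by (simp add: marking_eq pending_low contracted_low)

lemma pending_high:
  assumes "u < x"
  shows "pending contracted x y = pending L (x + d) (y + d)"
proof -
  have "(\<forall>y'. x + d \<le> y' \<and> y' \<le> y + d \<longrightarrow> \<psi> \<notin> L (x + d, y')) \<longleftrightarrow>
      (\<forall>y'. x \<le> y' \<and> y' \<le> y \<longrightarrow> \<psi> \<notin> contracted (x, y'))" for \<psi>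
  proof -
    have "(\<forall>y'. x + d \<le> y' \<and> y' \<le> y + d \<longrightarrow> \<psi> \<notin> L (x + d, y')) \<longleftrightarrow>
      (\<forall>y'. x \<le> y' \<and> y' \<le> y \<longrightarrow> \<psi> \<notin> L (x + d, y' + d))"
    proof (intro iffI allI impI)
      fix y' assume *: "\<forall>y'. x \<le> y' \<and> y' \<le> y \<longrightarrow> \<psi> \<notin> L (x + d, y' + d)"
        and "x + d \<le> y' \<and> y' \<le> y + d"
      then show "\<psi> \<notin> L (x + d, y')" using *[rule_format, of "y' - d"] by simp
    qed simp
    then show ?thesis using contracted_high[OF assms] by auto
  qed
  then show ?thesis
    unfolding pending_def by (simp add: contracted_high[OF assms])
qed

lemma marking_high: "u < x \<Longrightarrow> x \<le> y \<Longrightarrow> marking \<phi> contracted (x, y) = marking \<phi> L (x + d, y + d)"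
  by (simp add: marking_eq pending_high contracted_high)

text \<open>The diagonal point of column \<open>x\<close> lies below the cut, so its requests are
  unchanged; above the cut they are met by copied labels.\<close>

lemma pending_cross:
  assumes "x \<le> u" "u < y"
  shows "pending contracted x y
    = {\<psi> \<in> pending L x u. \<forall>B. v < B \<and> B \<le> y + d \<longrightarrow> \<psi> \<notin> L (g x B, B)}"
proof -
  have "(\<forall>B. u < B \<and> B \<le> y \<longrightarrow> \<psi> \<notin> contracted (x, B)) \<longleftrightarrow>
      (\<forall>B. v < B \<and> B \<le> y + d \<longrightarrow> \<psi> \<notin> L (g x B, B))" for \<psi>
  proof -
    have "(\<forall>B. v < B \<and> B \<le> y + d \<longrightarrow> \<psi> \<notin> L (g x B, B)) \<longleftrightarrow>
      (\<forall>B. v < B + d \<and> B + d \<le> y + d \<longrightarrow> \<psi> \<notin> L (g x (B + d), B + d))"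
    proof (intro iffI allI impI)
      fix B assume *: "\<forall>B. v < B + d \<and> B + d \<le> y + d \<longrightarrow> \<psi> \<notin> L (g x (B + d), B + d)"
        and "v < B \<and> B \<le> y + d"
      then show "\<psi> \<notin> L (g x B, B)" using *[rule_format, of "B - d"] by simp
    qed simp
    also have "\<dots> \<longleftrightarrow> (\<forall>B. u < B \<and> B \<le> y \<longrightarrow> \<psi> \<notin> contracted (x, B))"
      using contracted_cross[OF assms(1)] by (auto simp: d_def)
    finally show ?thesis by simp
  qed
  then show ?thesis
    using pending_split[of x u y contracted] assms pending_low[of x u] by simp
qed

text \<open>The truncated lengths agree at the cut, and from there both lengths grow by
  \<open>y - u\<close>.\<close>

lemma length_cross:
  assumes "state \<tau> v = state x u" "\<tau> \<le> v" "x \<le> u" "u < y"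
  shows "min (nat (y - x)) (k_max \<phi>) = min (nat (y + d - \<tau>)) (k_max \<phi>)"
proof -
  have "min (nat (v - \<tau>)) (k_max \<phi>) = min (nat (u - x)) (k_max \<phi>)"
    using assms(1) by (simp add: state_def)
  then show ?thesis using assms(2-4) unfolding d_def min_def by (auto split: if_splits)
qed

lemma marking_tracked:
  assumes "x \<le> u" "u < y" "\<tau> \<le> v" "state \<tau> v = state x u"
    and "\<And>B. v < B \<Longrightarrow> B \<le> y + d \<Longrightarrow> g x B = \<tau>"
  shows "marking \<phi> contracted (x, y) = marking \<phi> L (\<tau>, y + d)"
proof -
  have "v < y + d" using assms(2) by (simp add: d_def)
  moreover have "pending L \<tau> v = pending L x u" using assms(4) by (simp add: state_def)
  ultimately have "pending contracted x y = pending L \<tau> (y + d)"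
    using pending_cross[OF assms(1,2)] pending_split[of \<tau> v "y + d" L] assms(3,5) by auto
  then show ?thesis
    using length_cross[OF assms(4,3,1,2)] assms \<open>v < y + d\<close>
    by (simp add: marking_eq contracted_cross)
qed

text \<open>Switching between copied columns loses no fulfilment: the first row above
  \<open>v\<close> at which \<open>t x\<close> meets a request is busy, so \<open>t x\<close> itself
  is copied there. Nor is one gained, as every copied column has the same
  \<open>seen_right\<close>.\<close>

lemma pending_contracted_end:
  assumes x: "a \<le> x" "x \<le> u"
  shows "pending contracted x (e - d) = pending L x e"
proof -
  have "pending L (t x) v = pending L x u" and seen_t: "seen_right (t x) = seen_right x"
    using t_state[OF x] by (simp_all add: state_def)
  have seen_g: "seen_right (g x B) = seen_right x" for B
    using g_state[OF x, of B] by (simp add: state_def)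
  have "u < e - d" using uv by (simp add: d_def)
  then have eq: "pending contracted x (e - d)
      = {\<psi> \<in> pending L x u. \<forall>B. v < B \<and> B \<le> e \<longrightarrow> \<psi> \<notin> L (g x B, B)}"
    using pending_cross[of x "e - d"] x by simp
  also have "\<dots> = pending L x u - seen_right x"
  proof (intro equalityI subsetI)
    fix \<psi> assume \<psi>: "\<psi> \<in> {\<psi> \<in> pending L x u. \<forall>B. v < B \<and> B \<le> e \<longrightarrow> \<psi> \<notin> L (g x B, B)}"
    have "\<psi> \<notin> seen_right (t x)"
    proof
      assume "\<psi> \<in> seen_right (t x)"
      then obtain c where c: "t x \<le> c" "c \<le> e" "\<psi> \<in> L (t x, c)" by (auto simp: seen_right_def)
      have \<psi>t: "\<psi> \<in> pending L (t x) v" using \<psi> \<open>pending L (t x) v = pending L x u\<close> by simp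
      then have "v < c" using c unfolding pending_def by force
      have fin: "finite {c \<in> {v<..e}. \<psi> \<in> L (t x, c)}"
        by (rule finite_subset[of _ "{v<..e}"]) auto
      \<comment> \<open>The least such row is taken so that \<open>\<psi>\<close> is still pending
        at \<open>B - 1\<close>, which makes \<open>B\<close> busy.\<close>
      define B where "B = Min {c \<in> {v<..e}. \<psi> \<in> L (t x, c)}"
      have "B \<in> {c \<in> {v<..e}. \<psi> \<in> L (t x, c)}"
        unfolding B_def by (rule Min_in[OF fin]) (use c \<open>v < c\<close> in auto)
      then have B: "v < B" "B \<le> e" "\<psi> \<in> L (t x, B)" by auto
      have "\<psi> \<notin> L (t x, y)" if "v < y" "y \<le> B - 1" for y
      proof
        assume "\<psi> \<in> L (t x, y)"
        then have "B \<le> y" unfolding B_def by (intro Min_le[OF fin]) (use that B in auto)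
        then show False using that by simp
      qed
      then have "\<psi> \<in> pending L (t x) (B - 1)"
        using pending_split[of "t x" v "B - 1" L] t_state[OF x] B \<psi>t by auto
      then have "busy (t x) B" using B(3) by (auto simp: busy_def)
      then have "g x B = t x" by (rule g_busy[OF x])
      then show False using \<psi> B by auto
    qed
    then show "\<psi> \<in> pending L x u - seen_right x" using \<psi> seen_t by simp
  next
    fix \<psi> assume \<psi>: "\<psi> \<in> pending L x u - seen_right x"
    then have "\<psi> \<in> right_args \<phi>" using pending_subset[of x u] x uv by auto
    have "\<psi> \<notin> L (g x B, B)" if "v < B" "B \<le> e" for B
    proof
      assume "\<psi> \<in> L (g x B, B)"
      then have "\<psi> \<in> Obs_r \<phi> (L (g x B, B))"
        using \<open>\<psi> \<in> right_args \<phi>\<close> by (simp add: Obs_r_def right_args_def)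
      then have "\<psi> \<in> seen_right (g x B)"
        using Obs_r_subset_seen[of "g x B" B] g_state[OF x, of B] that by auto
      then show False using \<psi> seen_g by simp
    qed
    then show "\<psi> \<in> {\<psi> \<in> pending L x u. \<forall>B. v < B \<and> B \<le> e \<longrightarrow> \<psi> \<notin> L (g x B, B)}"
      using \<psi> by simp
  qed
  also have "\<dots> = pending L x e" using pending_end[of x u] x uv by simp
  finally show ?thesis .
qed

lemma marking_contracted_end:
  assumes x: "a \<le> x" "x \<le> u"
  shows "marking \<phi> contracted (x, e - d) = marking \<phi> L (t x, e)"
proof -
  have t: "a \<le> t x" "t x \<le> v" "state (t x) v = state x u" using t_state[OF x] by auto
  have "pending L x e = pending L x u - seen_right x" using pending_end[of x u] x uv by simp
  also have "\<dots> = pending L (t x) v - seen_right (t x)" using t(3) by (simp add: state_def)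
  also have "\<dots> = pending L (t x) e" using pending_end[of "t x" v] t uv by simp
  finally have "pending contracted x (e - d) = pending L (t x) e"
    using pending_contracted_end[OF x] by simp
  moreover have "u < e - d" using uv by (simp add: d_def)
  moreover have "g x e = t x" by (rule g_busy[OF x]) (simp add: busy_def)
  ultimately show ?thesis
    using length_cross[OF t(3,2) x(2) \<open>u < e - d\<close>] x
    by (simp add: marking_eq contracted_cross)
qed

text \<open>A column above \<open>v\<close> is shifted, and a column in \<open>Key\<close> has a
  follower. The flag in the state keeps the follower of a column right of \<open>p\<close> on the
  same side.\<close>

lemma Key_marking:
  assumes "v < y" "a \<le> x'" "x' \<le> y" "v < x' \<or> x' \<in> Key"
  shows "\<exists>x. a \<le> x \<and> x \<le> y - d \<and> (p \<le> x' \<longrightarrow> shift p \<le> x)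
    \<and> marking \<phi> contracted (x, y - d) = marking \<phi> L (x', y)"
proof (cases "v < x'")
  case True
  then have "marking \<phi> contracted (x' - d, y - d) = marking \<phi> L (x', y)"
    using marking_high[of "x' - d" "y - d"] assms by (simp add: d_def)
  moreover have "p \<le> x' \<longrightarrow> shift p \<le> x' - d" using True by (auto simp: shift_def d_def)
  ultimately show ?thesis using True assms uv by (intro exI[of _ "x' - d"]) (auto simp: d_def)
next
  case False
  then have "x' \<in> Key" using assms by simp
  then obtain x where x: "a \<le> x" "x \<le> u" "state x u = state x' v" "\<And>B. g x B = x'"
    using Key_tracked by blast
  have "u < y - d" using assms by (simp add: d_def)
  have "marking \<phi> contracted (x, y - d) = marking \<phi> L (x', y)"
    using marking_tracked[of x "y - d" x'] x False \<open>u < y - d\<close> by simp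
  moreover have "p \<le> x' \<longrightarrow> p \<le> x" using x(3) by (simp add: state_def)
  then have "p \<le> x' \<longrightarrow> shift p \<le> x" using x(2) by (auto simp: shift_def)
  ultimately show ?thesis using x \<open>u < y - d\<close> by (intro exI[of _ x]) auto
qed

lemma contracted_generator:
  "centred_generator \<phi> contracted a (e - d) (shift p) (shift z) (shift f)"
proof
  have d: "0 < d" "u + d = v" using uv by (simp_all add: d_def)
  fix x y assume x: "a \<le> x" "x \<le> y" "y \<le> e - d"
  show "contracted (x, y) \<in> atoms \<phi>"
    using x d g_state[of x "y + d"] by (auto simp: contracted_def intro!: atom)
next
  have d: "0 < d" "u + d = v" using uv by (simp_all add: d_def)
  fix x y w assume x: "a \<le> x" "x \<le> y" "y \<le> w" "w \<le> e - d"
  show "atom_rel \<phi> (contracted (x, y)) (contracted (y, w))"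
  \<comment> \<open>In the first case both labels come from old points that share a diagonal
    point.\<close>
  proof (cases "u < y \<or> w \<le> u")
    case True
    then show ?thesis
      using x d g_state[of x "y + d"] by (auto simp: contracted_def intro!: rel)
  next
    \<comment> \<open>Here \<open>(x, y)\<close> is below the cut and the label of
      \<open>(y, w)\<close> is copied from a column that need not be \<open>y\<close>; the seen sets
      mediate between them.\<close>
    case False
    then have y: "y \<le> u" "u < w" by auto
    let ?G = "g y (w + d)"
    have G: "a \<le> ?G" "?G \<le> v" "seen_right ?G = seen_right y" "seen_left ?G = seen_left y"
      using g_state[of y "w + d"] x y by (auto simp: state_def)
    have "Obs_r \<phi> (L (?G, w + d)) \<subseteq> seen_right ?G"
      using G x y d by (intro Obs_r_subset_seen) auto
    then have "Obs_r \<phi> (L (?G, w + d)) \<subseteq> Req_r (L (x, y))"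
      using G seen_right_subset_Req[of x y] x by auto
    moreover have "Obs_l \<phi> (L (x, y)) \<subseteq> seen_left y"
      using x by (intro Obs_l_subset_seen) auto
    then have "Obs_l \<phi> (L (x, y)) \<subseteq> Req_l (L (?G, w + d))"
      using G seen_left_subset_Req[of ?G "w + d"] x y d by auto
    ultimately show ?thesis
      using y by (simp add: atom_rel_def contracted_low contracted_cross)
  qed
next
  have d: "0 < d" "u + d = v" using uv by (simp_all add: d_def)
  fix x y j assume x: "a \<le> x" "x \<le> y" "y \<le> e - d" and j: "LenLt j \<in> contracted (x, y)"
  show "y - x < int j"
  proof (cases "u < y \<and> x \<le> u")
    case True
    let ?G = "g x (y + d)"
    have G: "a \<le> ?G" "?G \<le> v" "state ?G v = state x u"
      using g_state[of x "y + d"] x True by auto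
    have jL: "LenLt j \<in> L (?G, y + d)" using j True by (simp add: contracted_cross)
    then have "y + d - ?G < int j" using G x True d by (intro len) auto
    moreover have "L (?G, y + d) \<in> atoms \<phi>" using G x True d by (intro atom) auto
    then have "j \<le> k_max \<phi>" using jL atom_subset_Cl LenLt_Cl_le_k_max by blast
    \<comment> \<open>Since \<open>j\<close> is at most \<open>k_max \<phi>\<close>, equality of the
      truncated lengths transfers the constraint.\<close>
    ultimately show ?thesis
      using length_cross[of ?G x y] G True d by (auto simp: min_def split: if_splits)
  next
    case False
    show ?thesis
    proof (cases "y \<le> u")
      case True
      then show ?thesis using len[of x y j] j x d by (simp add: contracted_low)
    next
      case F: False
      then show ?thesis using False len[of "x + d" "y + d" j] j x d by (simp add: contracted_high)
    qed
  qed
next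
  show "a + int (k_max \<phi>) \<le> shift p" using bounds p_kept uv by (auto simp: shift_def d_def)
  show "shift p < shift z" using bounds z_kept p_kept uv by (auto simp: shift_def d_def)
  show "shift z < shift f" using bounds z_kept f_kept uv by (auto simp: shift_def d_def)
  show "shift f + int (k_max \<phi>) \<le> e - d" using bounds f_kept uv by (auto simp: shift_def d_def)
next
  have d: "0 < d" "u + d = v" using uv by (simp_all add: d_def)
  fix y \<psi> assume y: "shift p \<le> y" "y \<le> e - d" and \<psi>: "\<psi> \<in> Req_l (contracted (y, y))"
  show "\<exists>x. a \<le> x \<and> x \<le> y \<and> \<psi> \<in> contracted (x, y)"
  proof (cases "y \<le> u")
    case True
    then have "p \<le> y" using y p_kept uv by (auto simp: shift_def d_def split: if_splits)
    then show ?thesis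
      using left_fulfilled[of y \<psi>] \<psi> True y d by (auto simp: contracted_low)
  next
    case False
    have py: "p \<le> y + d" using y False d by (auto simp: shift_def split: if_splits)
    have "\<psi> \<in> Req_l (L (y + d, y + d))" using \<psi> False by (simp add: contracted_high)
    then obtain x where x: "a \<le> x" "x \<le> y + d" "\<psi> \<in> L (x, y + d)"
      using left_fulfilled[of "y + d" \<psi>] py y by auto
    show ?thesis
    proof (cases "v < x")
      case True
      then show ?thesis
        using x False d uv by (intro exI[of _ "x - d"]) (auto simp: contracted_high)
    next
      \<comment> \<open>The old witness lies in a column up to \<open>v\<close>, which need not have
        a follower, but some column copies a witness of \<open>\<psi>\<close> at this very
        row.\<close>
      case xv: False
      have "a \<le> y + d" "y + d \<le> e" using uv False y d by auto
      then have "\<psi> \<in> left_args \<phi>"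
        using \<open>\<psi> \<in> Req_l (L (y + d, y + d))\<close> atom_subset_Cl[OF atom[of "y + d" "y + d"]]
        unfolding Req_l_def left_args_def by auto
      then obtain x' where "a \<le> x'" "x' \<le> u" "\<psi> \<in> L (g x' (y + d), y + d)"
        using witness[of "y + d" \<psi> x] x xv py False d by auto
      then show ?thesis using False by (intro exI[of _ x']) (auto simp: contracted_cross)
    qed
  qed
next
  have d: "0 < d" "u + d = v" using uv by (simp_all add: d_def)
  fix x assume x: "a \<le> x" "x \<le> e - d"
  \<comment> \<open>The new last row shows only markings of the old last row, so the old witnesses
    suffice.\<close>
  obtain w where w: "a \<le> w" "w \<le> e" "marking \<phi> contracted (x, e - d) = marking \<phi> L (w, e)"
  proof (cases "x \<le> u")
    case True
    then show thesis using that[of "t x"] marking_contracted_end[of x] t_state[of x] x uv by auto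
  next
    case False
    then show thesis using that[of "x + d"] marking_high[of x "e - d"] x d by auto
  qed
  obtain x' where x': "a \<le> x'" "x' \<le> f" "marking \<phi> L (x', f) = marking \<phi> L (w, e)" "v < x' \<or> x' \<in> Key"
    using Key_future[OF w(1,2)] by blast
  show "\<exists>x'. a \<le> x' \<and> x' \<le> shift f
      \<and> marking \<phi> contracted (x', shift f) = marking \<phi> contracted (x, e - d)"
  proof (cases "f \<le> u")
    case True
    then show ?thesis using x' w marking_low[of x' f] by (auto simp: shift_def)
  next
    case False
    then have "v < f" using f_kept by auto
    then show ?thesis
      using Key_marking[of f x'] x' w False by (auto simp: shift_def)
  qed
next
  have d: "0 < d" "u + d = v" using uv by (simp_all add: d_def)
  fix x assume x: "a \<le> x" "x \<le> shift f"
  show "pending contracted x (e - d) = {}"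
  proof (cases "x \<le> u")
    case True
    then have "x \<le> f" using x d by (auto simp: shift_def split: if_splits)
    then show ?thesis using pending_contracted_end[of x] right_fulfilled[of x] x True by simp
  next
    case False
    then show ?thesis
      using pending_high[of x "e - d"] right_fulfilled[of "x + d"] x d
      by (auto simp: shift_def split: if_splits)
  qed
next
  have d: "0 < d" "u + d = v" using uv by (simp_all add: d_def)
  fix x assume x: "a \<le> x" "x \<le> shift p"
  obtain w where w: "a \<le> w" "w \<le> p" "marking \<phi> contracted (x, shift p) = marking \<phi> L (w, p)"
  proof (cases "p \<le> u")
    case True
    then show thesis using that[of x] marking_low[of x p] x by (auto simp: shift_def)
  next
    case False
    then have p: "v < p" using p_kept by linarith
    show thesis
    proof (cases "x \<le> u")
      case True
      \<comment> \<open>All rows up to \<open>p\<close> are busy, so \<open>x\<close> copies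
        \<open>t x\<close> without interruption there.\<close>
      have "marking \<phi> contracted (x, p - d) = marking \<phi> L (t x, p - d + d)"
        by (rule marking_tracked)
          (use True p d x t_state[of x] g_busy[of x] in \<open>auto simp: busy_def\<close>)
      then show thesis
        using that[of "t x"] t_state[of x] True x p False by (simp add: shift_def)
    next
      case xu: False
      then show thesis
        using that[of "x + d"] marking_high[of x "p - d"] x d False by (auto simp: shift_def)
    qed
  qed
  obtain x' where x': "p \<le> x'" "x' \<le> z" "marking \<phi> L (x', z) = marking \<phi> L (w, p)" "v < x' \<or> x' \<in> Key"
    using Key_past[OF w(1,2)] by blast
  show "\<exists>x'. shift p \<le> x' \<and> x' \<le> shift z
      \<and> marking \<phi> contracted (x', shift z) = marking \<phi> contracted (x, shift p)"
  proof (cases "z \<le> u")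
    case True
    then show ?thesis using x' w marking_low[of x' z] bounds by (auto simp: shift_def)
  next
    case False
    then have "v < z" using z_kept by auto
    moreover have "a \<le> x'" using x' bounds by linarith
    ultimately show ?thesis
      using Key_marking[of z x'] x' w False by (auto simp: shift_def)
  qed
next
  have d: "0 < d" "u + d = v" using uv by (simp_all add: d_def)
  obtain x y where x: "a \<le> x" "x \<le> y" "y \<le> e" "norm_neg \<phi> \<in> L (x, y)"
      "y \<le> u \<or> v < y \<and> (v < x \<or> x \<in> Key)"
    using Key_featured by blast
  show "\<exists>x y. a \<le> x \<and> x \<le> y \<and> y \<le> e - d \<and> norm_neg \<phi> \<in> contracted (x, y)"
  proof (cases "y \<le> u")
    case True
    then show ?thesis using x d uv by (intro exI[of _ x] exI[of _ y]) (auto simp: contracted_low)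
  next
    case False
    then obtain x' where "a \<le> x'" "x' \<le> y - d" "marking \<phi> contracted (x', y - d) = marking \<phi> L (x, y)"
      using Key_marking[of y x] x by auto
    then show ?thesis using x by (intro exI[of _ x'] exI[of _ "y - d"]) (auto simp: marking_eq)
  qed
qed

end

section \<open>Minimal generators\<close>

lemma column_marks_card: "finite (column_marks \<phi>)" "2 * card (column_marks \<phi>) \<le> 4 ^ mpnl_length \<phi>"
proof -
  show "finite (column_marks \<phi>)"
    by (simp add: column_marks_def card_atoms_le finite_right_args)
  have "card (column_marks \<phi>) = card (atoms \<phi>) * (2 ^ card (right_args \<phi>) * (k_max \<phi> + 1))"
    by (simp add: column_marks_def card_cartesian_product card_Pow finite_right_args)
  also have "\<dots> \<le> 2 ^ card (subformulae \<phi>) * (2 ^ card (right_args \<phi>) * 2 ^ floorlog 2 (k_max \<phi>))"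
    by (intro mult_le_mono card_atoms_le k_max_less order_refl)
  also have "\<dots> = 2 ^ (card (subformulae \<phi>) + card (right_args \<phi>) + floorlog 2 (k_max \<phi>))"
    by (simp add: power_add)
  finally have "2 * card (column_marks \<phi>)
      \<le> 2 ^ (card (subformulae \<phi>) + card (right_args \<phi>) + floorlog 2 (k_max \<phi>) + 1)" by simp
  also have "\<dots> \<le> 2 ^ (2 * mpnl_length \<phi>)"
    using card_subformulae_le[of \<phi>] card_args_le[of \<phi>] by (intro power_increasing) auto
  finally show "2 * card (column_marks \<phi>) \<le> 4 ^ mpnl_length \<phi>" by (simp add: power_mult)
qed

text \<open>The first two summands bound \<open>Key\<close>: one witness for \<open>future\<close>
  and one for \<open>past\<close> per mark, and one column featuring the formula. The last is the
  share of the left witnesses in \<open>class_assignment\<close>.\<close>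

definition threshold :: "'p mpnl \<Rightarrow> nat" where
  "threshold \<phi> = 2 * card (column_marks \<phi>) + 1
     + card (left_args \<phi>) * (card (right_args \<phi>) + 3)"

definition states :: "'p mpnl \<Rightarrow> ('p mpnl set \<times> 'p mpnl set \<times> 'p mpnl set \<times> nat \<times> bool) set" where
  "states \<phi> = Pow (right_args \<phi>) \<times> Pow (right_args \<phi>) \<times> Pow (left_args \<phi>) \<times> {0..k_max \<phi>} \<times> UNIV"

text \<open>The factor 2 is kept for the final estimate, where a base 3 is replaced by a
  square.\<close>

lemma states_card: "finite (states \<phi>)" "2 * card (states \<phi>) \<le> 4 ^ mpnl_length \<phi>"
proof -
  show "finite (states \<phi>)"
    by (simp add: states_def finite_right_args finite_left_args)
  have "2 * card (states \<phi>)
      = 2 ^ (card (right_args \<phi>) + card (right_args \<phi>) + card (left_args \<phi>) + 2) * (k_max \<phi> + 1)"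
    by (simp add: states_def card_cartesian_product card_Pow finite_right_args finite_left_args
        power_add algebra_simps)
  also have "\<dots> \<le> 2 ^ (card (right_args \<phi>) + card (right_args \<phi>) + card (left_args \<phi>) + 2) * 2 ^ floorlog 2 (k_max \<phi>)"
    by (intro mult_le_mono k_max_less order_refl)
  also have "\<dots> = 2 ^ (card (right_args \<phi>) + card (right_args \<phi>) + card (left_args \<phi>) + 2 + floorlog 2 (k_max \<phi>))"
    by (simp add: power_add)
  also have "\<dots> \<le> 2 ^ (2 * mpnl_length \<phi>)"
    using card_args_le[of \<phi>] by (intro power_increasing) auto
  finally show "2 * card (states \<phi>) \<le> 4 ^ mpnl_length \<phi>" by (simp add: power_mult)
qed

lemma threshold_less: "threshold \<phi> + 1 \<le> 9 ^ mpnl_length \<phi>"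
proof -
  let ?n = "mpnl_length \<phi>"
  have n: "1 \<le> ?n" using card_args_le[of \<phi>] by simp
  have lr: "card (left_args \<phi>) + card (right_args \<phi>) \<le> ?n - 1" using card_args_le[of \<phi>] by simp
  have "card (left_args \<phi>) * (card (right_args \<phi>) + 3) \<le> (?n - 1) * (?n + 2)"
    using lr n by (intro mult_le_mono) auto
  also have "(?n - 1) * (?n + 2) + 2 = ?n * ?n + ?n"
    using n by (cases ?n) (auto simp: algebra_simps)
  finally have "threshold \<phi> + 1 \<le> 4 ^ ?n + (?n * ?n + ?n)"
    using column_marks_card(2)[of \<phi>] \<open>(?n - 1) * (?n + 2) + 2 = ?n * ?n + ?n\<close>
    unfolding threshold_def by linarith
  \<comment> \<open>The power of 5 absorbs the quadratic term, leaving a single power of 9.\<close>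
  also have "m * m + m \<le> 5 ^ m \<and> 4 ^ m + 5 ^ m \<le> (9 :: nat) ^ m" if "1 \<le> m" for m :: nat
    using that
  proof (induction m rule: nat_induct_at_least)
    case (Suc m)
    have "Suc m * Suc m + Suc m \<le> 5 * (m * m + m)" using Suc.hyps by (cases m) (auto simp: algebra_simps)
    then show ?case using Suc by simp
  qed simp
  then have "4 ^ ?n + (?n * ?n + ?n) \<le> 9 ^ ?n" using n by force
  finally show ?thesis .
qed

context centred_generator
begin

definition profile :: "int \<Rightarrow> 'p mpnl set \<times> 'p mpnl set \<times> 'p mpnl set \<times> nat \<times> bool \<Rightarrow> nat" where
  "profile y \<sigma> = min (threshold \<phi>) (card {x \<in> {a..y}. state x y = \<sigma>})"

lemma state_in_states:
  assumes "a \<le> x" "x \<le> y" "y \<le> e"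
  shows "state x y \<in> states \<phi>"
  using assms pending_subset[of x y] unfolding state_def states_def seen_right_def seen_left_def by auto

lemma contraction_exists:
  assumes uv: "a \<le> u" "u < v" "v < e"
    and kept: "p \<le> u \<or> v + int (k_max \<phi>) < p" "z \<le> u \<or> v < z" "f + int (k_max \<phi>) \<le> u \<or> v < f"
    and c: "a \<le> c" "c \<le> c'" "c' \<le> e" "norm_neg \<phi> \<in> L (c, c')" "c' \<le> u \<or> v < c'"
    and prof: "profile u = profile v"
  shows "\<exists>L' p' z' f'. centred_generator \<phi> L' a (e - (v - u)) p' z' f'"
proof -
  define fut where "fut m = (SOME x'. a \<le> x' \<and> x' \<le> f \<and> marking \<phi> L (x', f) = m)" for m
  define pst where "pst m = (SOME x'. p \<le> x' \<and> x' \<le> z \<and> marking \<phi> L (x', z) = m)" for m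
  have fut: "a \<le> fut (marking \<phi> L (x, e)) \<and> fut (marking \<phi> L (x, e)) \<le> f
      \<and> marking \<phi> L (fut (marking \<phi> L (x, e)), f) = marking \<phi> L (x, e)" if "a \<le> x" "x \<le> e" for x
    unfolding fut_def by (rule someI_ex) (rule future[OF that])
  have pst: "p \<le> pst (marking \<phi> L (x, p)) \<and> pst (marking \<phi> L (x, p)) \<le> z
      \<and> marking \<phi> L (pst (marking \<phi> L (x, p)), z) = marking \<phi> L (x, p)" if "a \<le> x" "x \<le> p" for x
    unfolding pst_def by (rule someI_ex) (rule past[OF that])
  \<comment> \<open>Witnesses are chosen per mark rather than per column, which bounds their number.
    Those right of \<open>v\<close> are shifted and need no follower.\<close>
  define Key where "Key = {a..v} \<inter> ({c} \<union> (fut ` column_marks \<phi> \<union> pst ` column_marks \<phi>))"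
  have fin: "finite ({c} \<union> (fut ` column_marks \<phi> \<union> pst ` column_marks \<phi>))"
    by (simp add: column_marks_card)
  have "card Key \<le> card ({c} \<union> (fut ` column_marks \<phi> \<union> pst ` column_marks \<phi>))"
    unfolding Key_def by (rule card_mono[OF fin]) simp
  also have "\<dots> \<le> 1 + (card (column_marks \<phi>) + card (column_marks \<phi>))"
    by (intro order_trans[OF card_Un_le] add_mono card_image_le column_marks_card) simp
  finally have Key_card: "card Key \<le> 2 * card (column_marks \<phi>) + 1" by simp
  define X where "X \<sigma> = {x \<in> {a..u}. state x u = \<sigma>}" for \<sigma>
  define Y where "Y \<sigma> = {x \<in> {a..v}. state x v = \<sigma>}" for \<sigma>
  define Q where "Q \<sigma> g t \<longleftrightarrow>
      (\<forall>x\<in>X \<sigma>. t x \<in> Y \<sigma> \<and> (\<forall>B. g x B \<in> Y \<sigma> \<and> (busy (t x) B \<longrightarrow> g x B = t x)))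
      \<and> (\<forall>\<kappa>\<in>Key \<inter> Y \<sigma>. \<exists>x\<in>X \<sigma>. \<forall>B. g x B = \<kappa>)
      \<and> (\<forall>B \<psi>. v < B \<and> p \<le> B \<and> \<psi> \<in> left_args \<phi> \<and> (\<exists>y\<in>Y \<sigma>. \<psi> \<in> L (y, B))
          \<longrightarrow> (\<exists>x\<in>X \<sigma>. \<psi> \<in> L (g x B, B)))" for \<sigma> g t
  have "\<exists>g t. Q \<sigma> g t" for \<sigma>
    unfolding Q_def
  proof (rule class_assignment[where T = "threshold \<phi>"])
    show "finite (X \<sigma>)" "finite (Y \<sigma>)"
      by (rule finite_subset[of _ "{a..v}"]; use uv in \<open>auto simp: X_def Y_def\<close>)+
    have "min (threshold \<phi>) (card (X \<sigma>)) = min (threshold \<phi>) (card (Y \<sigma>))"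
      using fun_cong[OF prof, of \<sigma>] by (simp add: profile_def X_def Y_def)
    then show "card (X \<sigma>) = card (Y \<sigma>) \<or> threshold \<phi> \<le> card (X \<sigma>) \<and> threshold \<phi> \<le> card (Y \<sigma>)"
      by (auto simp: min_def split: if_splits)
    show "0 < threshold \<phi>" by (simp add: threshold_def)
    show "Y \<sigma> \<subseteq> {a..v}" by (auto simp: Y_def)
    show "v < e" by (rule uv)
    show "Key \<inter> Y \<sigma> \<subseteq> Y \<sigma>" by simp
    have "card (Key \<inter> Y \<sigma>) \<le> card Key"
      by (rule card_mono) (auto simp: Key_def)
    then show "card (Key \<inter> Y \<sigma>) + card (left_args \<phi>) * (card (right_args \<phi>) + 3) \<le> threshold \<phi>"
      using Key_card by (simp add: threshold_def)
  qed
  then obtain G H where GH: "\<And>\<sigma>. Q \<sigma> (G \<sigma>) (H \<sigma>)" by metis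
  note GH1 = GH[unfolded Q_def, THEN conjunct1, rule_format]
  note GH2 = GH[unfolded Q_def, THEN conjunct2, THEN conjunct1, rule_format]
  note GH3 = GH[unfolded Q_def, THEN conjunct2, THEN conjunct2, rule_format]
  \<comment> \<open>Each column uses the assignment made for its own state at
    \<open>u\<close>.\<close>
  define g where "g x = G (state x u) x" for x
  define t where "t x = H (state x u) x" for x
  have mem: "x \<in> X (state x u)" if "a \<le> x" "x \<le> u" for x
    using that by (simp add: X_def)
  interpret contraction_map \<phi> L a e p z f u v g t Key
  proof unfold_locales
    fix x assume x: "a \<le> x" "x \<le> u"
    show "a \<le> t x \<and> t x \<le> v \<and> state (t x) v = state x u"
      using GH1[OF mem[OF x]] by (simp add: t_def Y_def)
    show "a \<le> g x B \<and> g x B \<le> v \<and> state (g x B) v = state x u" for B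
      using GH1[OF mem[OF x]] by (simp add: g_def Y_def)
    show "busy (t x) B \<Longrightarrow> g x B = t x" for B
      using GH1[OF mem[OF x]] by (simp add: g_def t_def)
  next
    fix \<kappa> assume \<kappa>: "\<kappa> \<in> Key"
    then have "\<kappa> \<in> Key \<inter> Y (state \<kappa> v)" by (simp add: Key_def Y_def)
    from GH2[OF this] obtain x where "x \<in> X (state \<kappa> v)" "\<And>B. G (state \<kappa> v) x B = \<kappa>" by blast
    then show "\<kappa> \<le> v \<and> (\<exists>x. a \<le> x \<and> x \<le> u \<and> state x u = state \<kappa> v \<and> (\<forall>B. g x B = \<kappa>))"
      using \<kappa> by (auto simp: X_def Key_def g_def)
  next
    fix B \<psi> y assume B: "v < B" "p \<le> B" "\<psi> \<in> left_args \<phi>" and y: "a \<le> y" "y \<le> v" "\<psi> \<in> L (y, B)"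
    have "y \<in> Y (state y v)" using y by (simp add: Y_def)
    then have "\<exists>x\<in>X (state y v). \<psi> \<in> L (G (state y v) x B, B)"
      using GH3[of B \<psi> "state y v"] B y by blast
    then show "\<exists>x. a \<le> x \<and> x \<le> u \<and> \<psi> \<in> L (g x B, B)"
      by (auto simp: X_def g_def)
  next
    show "\<exists>x y. a \<le> x \<and> x \<le> y \<and> y \<le> e \<and> norm_neg \<phi> \<in> L (x, y)
        \<and> (y \<le> u \<or> v < y \<and> (v < x \<or> x \<in> Key))"
      using c by (intro exI[of _ c] exI[of _ c']) (auto simp: Key_def)
  next
    fix x assume x: "a \<le> x" "x \<le> e"
    have "marking \<phi> L (x, e) \<in> column_marks \<phi>" using marking_in_column_marks[of x e] x by simp
    then show "\<exists>x'. a \<le> x' \<and> x' \<le> f \<and> marking \<phi> L (x', f) = marking \<phi> L (x, e) \<and> (v < x' \<or> x' \<in> Key)"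
      using fut[OF x] by (intro exI[of _ "fut (marking \<phi> L (x, e))"]) (auto simp: Key_def)
  next
    fix x assume x: "a \<le> x" "x \<le> p"
    have "marking \<phi> L (x, p) \<in> column_marks \<phi>" using marking_in_column_marks[of x p] x bounds by simp
    then show "\<exists>x'. p \<le> x' \<and> x' \<le> z \<and> marking \<phi> L (x', z) = marking \<phi> L (x, p) \<and> (v < x' \<or> x' \<in> Key)"
      using pst[OF x] bounds by (intro exI[of _ "pst (marking \<phi> L (x, p))"]) (auto simp: Key_def)
  qed (use uv kept in auto)
  show ?thesis using contracted_generator unfolding d_def by blast
qed

lemma minimal_card:
  assumes minimal: "\<And>L' e' p' z' f'. centred_generator \<phi> L' a e' p' z' f' \<Longrightarrow> e \<le> e'"
  shows "card {a..e} \<le> (2 * k_max \<phi> + 6) * (threshold \<phi> + 1) ^ card (states \<phi>)"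
proof -
  obtain c c' where c: "a \<le> c" "c \<le> c'" "c' \<le> e" "norm_neg \<phi> \<in> L (c, c')" using featured by blast
  let ?k = "int (k_max \<phi>)"
  \<comment> \<open>No row of \<open>S\<close> may be removed. The two blocks of
    \<open>k_max \<phi> + 1\<close> rows secure the margins at \<open>p\<close> and
    \<open>f\<close>, and \<open>e\<close> forces \<open>v < e\<close>.\<close>
  define S where "S = {p - ?k..p} \<union> ({f..f + ?k} \<union> {z, e, c'})"
  have S: "finite S" by (simp add: S_def)
  have "card S \<le> (k_max \<phi> + 1) + ((k_max \<phi> + 1) + 3)"
    unfolding S_def by (intro order_trans[OF card_Un_le] add_mono) (auto simp: card_insert_if)
  then have card_S: "card S + 1 \<le> 2 * k_max \<phi> + 6" by simp
  \<comment> \<open>The first component tells whether a row of \<open>S\<close> lies between two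
    rows: the sets \<open>S \<inter> {..y}\<close> are nested, so equal cardinalities make them
    equal.\<close>
  define F where "F y = (card (S \<inter> {..y}), restrict (profile y) (states \<phi>))" for y
  have neq: "F u \<noteq> F v" if uv: "a \<le> u" "u < v" "v \<le> e" for u v
  proof
    assume eq: "F u = F v"
    have eqS: "S \<inter> {..u} = S \<inter> {..v}"
      by (rule card_subset_eq) (use that eq S in \<open>auto simp: F_def\<close>)
    have avoid: "s \<le> u \<or> v < s" if "s \<in> S" for s
    proof -
      have "s \<in> S \<inter> {..u} \<longleftrightarrow> s \<in> S \<inter> {..v}" by (simp only: eqS)
      then show ?thesis using that by auto
    qed
    have "profile u = profile v"
    proof
      fix \<sigma>
      show "profile u \<sigma> = profile v \<sigma>"
      proof (cases "\<sigma> \<in> states \<phi>")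
        case True
        have "restrict (profile u) (states \<phi>) \<sigma> = restrict (profile v) (states \<phi>) \<sigma>"
          using eq by (simp add: F_def)
        then show ?thesis using True by simp
      next
        case False
        then have empty: "{x \<in> {a..y}. state x y = \<sigma>} = {}" if "y \<le> e" for y
          using state_in_states that by auto
        have "u \<le> e" using that by simp
        then show ?thesis unfolding profile_def by (simp only: empty that)
      qed
    qed
    moreover have "p \<le> u \<or> v + ?k < p"
    proof (rule ccontr)
      assume "\<not> ?thesis"
      then have n: "u < p" "p - ?k \<le> v" by auto
      \<comment> \<open>If the margin at \<open>p\<close> failed, \<open>min v p\<close> would be a
        row of \<open>S\<close> inside \<open>{u<..v}\<close>; \<open>min v (f + ?k)\<close> serves
        likewise at \<open>f\<close>.\<close>
      then have "min v p \<in> S" by (simp add: S_def)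
      from avoid[OF this] show False using n that by (simp add: min_def split: if_splits)
    qed
    moreover have "f + ?k \<le> u \<or> v < f"
    proof (rule ccontr)
      assume "\<not> ?thesis"
      then have n: "u < f + ?k" "f \<le> v" by auto
      then have "min v (f + ?k) \<in> S" by (simp add: S_def)
      from avoid[OF this] show False using n that by (simp add: min_def split: if_splits)
    qed
    moreover have "z \<le> u \<or> v < z" "c' \<le> u \<or> v < c'" by (auto intro!: avoid simp: S_def)
    moreover have "v < e" using avoid[of e] that by (auto simp: S_def)
    ultimately obtain L' p' z' f' where "centred_generator \<phi> L' a (e - (v - u)) p' z' f'"
      using contraction_exists[of u v c c'] uv c by blast
    then have "e \<le> e - (v - u)" by (rule minimal)
    then show False using uv by simp
  qed
  have "inj_on F {a..e}"
    by (rule linorder_inj_onI) (use neq in auto)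
  moreover have "F ` {a..e} \<subseteq> {0..card S} \<times> (states \<phi> \<rightarrow>\<^sub>E {0..threshold \<phi>})"
    using card_mono[OF S] by (auto simp: F_def profile_def)
  moreover have "finite ({0..card S} \<times> (states \<phi> \<rightarrow>\<^sub>E {0..threshold \<phi>}))"
    by (intro finite_cartesian_product finite_PiE states_card) auto
  ultimately have "card {a..e} \<le> card ({0..card S} \<times> (states \<phi> \<rightarrow>\<^sub>E {0..threshold \<phi>}))"
    by (rule card_inj_on_le)
  also have "\<dots> = (card S + 1) * (threshold \<phi> + 1) ^ card (states \<phi>)"
    by (simp add: card_cartesian_product card_PiE states_card)
  also have "\<dots> \<le> (2 * k_max \<phi> + 6) * (threshold \<phi> + 1) ^ card (states \<phi>)"
    using card_S by (intro mult_le_mono) auto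
  finally show ?thesis .
qed

section \<open>Moving the centre to 0\<close>

lemma marking_translate:
  "marking \<phi> (\<lambda>(x, y). L (x + s, y + s)) (x, y) = marking \<phi> L (x + s, y + s)"
proof -
  have "(\<forall>y'. x + s \<le> y' \<and> y' \<le> y + s \<longrightarrow> P y') \<longleftrightarrow> (\<forall>y'. x \<le> y' \<and> y' \<le> y \<longrightarrow> P (y' + s))" for P
  proof (intro iffI allI impI)
    fix y' assume *: "\<forall>y'. x \<le> y' \<and> y' \<le> y \<longrightarrow> P (y' + s)" and "x + s \<le> y' \<and> y' \<le> y + s"
    then show "P y'" using *[rule_format, of "y' - s"] by simp
  qed simp
  then show ?thesis by (simp add: marking_def)
qed

lemma translated_generator:
  "Z_compass_generator \<phi> {a - z..e - z} (\<lambda>(x, y). L (x + z, y + z))"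
  "features {a - z..e - z} (\<lambda>(x, y). L (x + z, y + z)) \<phi>"
proof -
  let ?D = "{a - z..e - z}" and ?L = "\<lambda>(x, y). L (x + z, y + z)"
  have pts: "(x, y) \<in> points ?D \<longleftrightarrow> a \<le> x + z \<and> x \<le> y \<and> y + z \<le> e" for x y
    by (auto simp: points_def)
  have config_pos: "0 < config \<phi> ?D ?L y m \<longleftrightarrow>
      (\<exists>x. a \<le> x + z \<and> x \<le> y \<and> y + z \<le> e \<and> marking \<phi> L (x + z, y + z) = m)" for y m
  proof -
    have "finite {x. (x, y) \<in> points ?D \<and> marking \<phi> ?L (x, y) = m}"
      by (rule finite_subset[of _ ?D]) (auto simp: points_def)
    then show ?thesis
      unfolding config_def card_gt_0_iff pts marking_translate by auto
  qed
  have comp: "compass_structure \<phi> ?D ?L"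
    unfolding compass_structure_def
  proof (intro conjI ballI allI impI)
    fix q assume "q \<in> points ?D"
    then show "?L q \<in> atoms \<phi>" using atom by (cases q) (auto simp: pts)
  next
    fix x y x' y' assume "(x, y) \<in> points ?D \<and> (x', y') \<in> points ?D \<and> y = x'"
    then show "atom_rel \<phi> (?L (x, y)) (?L (x', y'))" using rel by (auto simp: pts)
  next
    fix x y j assume "(x, y) \<in> points ?D \<and> LenLt j \<in> ?L (x, y)"
    then show "y - x < int j" using len[of "x + z" "y + z" j] by (auto simp: pts)
  qed
  have fulfilled: "\<forall>y. p - z \<le> y \<and> y \<le> e - z \<longrightarrow> l_requests_fulfilled ?D ?L (y, y)"
  proof (intro allI impI)
    fix y assume y: "p - z \<le> y \<and> y \<le> e - z"
    show "l_requests_fulfilled ?D ?L (y, y)"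
      unfolding l_requests_fulfilled_def
    proof
      fix \<psi> assume "\<psi> \<in> Req_l (?L (y, y))"
      then obtain x where "a \<le> x" "x \<le> y + z" "\<psi> \<in> L (x, y + z)"
        using left_fulfilled[of "y + z" \<psi>] y by auto
      then show "\<exists>x'. (x', fst (y, y)) \<in> points ?D \<and> \<psi> \<in> ?L (x', fst (y, y))"
        using y by (intro exI[of _ "x - z"]) (auto simp: pts)
    qed
  qed
  have fut: "\<forall>m\<in>marked_atoms \<phi>. 0 < config \<phi> ?D ?L (e - z) m \<longrightarrow> 0 < config \<phi> ?D ?L (f - z) m"
  proof (intro ballI impI)
    fix m assume "0 < config \<phi> ?D ?L (e - z) m"
    then obtain x where "a \<le> x + z" "x + z \<le> e" "marking \<phi> L (x + z, e) = m"
      unfolding config_pos by auto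
    then obtain x' where "a \<le> x'" "x' \<le> f" "marking \<phi> L (x', f) = m" using future by blast
    then show "0 < config \<phi> ?D ?L (f - z) m"
      unfolding config_pos using bounds by (intro exI[of _ "x' - z"]) auto
  qed
  have rf: "\<forall>x. a - z \<le> x \<and> x \<le> f - z \<longrightarrow> (\<exists>F h. marking \<phi> ?L (x, e - z) = (F, {}, h))"
    using right_fulfilled by (simp add: marking_translate marking_eq[of \<phi> L])
  have pst: "\<forall>m\<in>marked_atoms \<phi>. 0 < config \<phi> ?D ?L (p - z) m
      \<longrightarrow> (\<exists>x. p - z \<le> x \<and> x \<le> 0 \<and> marking \<phi> ?L (x, 0) = m)"
  proof (intro ballI impI)
    fix m assume "0 < config \<phi> ?D ?L (p - z) m"
    then obtain x where "a \<le> x + z" "x + z \<le> p" "marking \<phi> L (x + z, p) = m"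
      unfolding config_pos by auto
    then obtain x' where "p \<le> x'" "x' \<le> z" "marking \<phi> L (x', z) = m" using past by blast
    then show "\<exists>x. p - z \<le> x \<and> x \<le> 0 \<and> marking \<phi> ?L (x, 0) = m"
      unfolding marking_translate by (intro exI[of _ "x' - z"]) auto
  qed
  show "Z_compass_generator \<phi> ?D ?L"
    unfolding Z_compass_generator_def
    by (rule conjI[OF comp], rule exI[of _ "a - z"], rule exI[of _ "e - z"],
        rule exI[of _ "p - z"], rule exI[of _ "f - z"])
      (intro conjI fulfilled fut rf pst; use bounds in simp)
  obtain x y where "a \<le> x" "x \<le> y" "y \<le> e" "norm_neg \<phi> \<in> L (x, y)" using featured by blast
  then show "features ?D ?L \<phi>"
    unfolding features_def by (intro bexI[of _ "(x - z, y - z)"]) (auto simp: pts)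
qed

end

section \<open>Compass generators are centred generators\<close>

lemma centred_generator_of_Z_compass_generator:
  assumes gen: "Z_compass_generator \<phi> D L" and feat: "features D L \<phi>"
  shows "\<exists>a e p f. centred_generator \<phi> L a e p 0 f"
proof -
  obtain a e p f where D: "D = {a..e}" and comp: "compass_structure \<phi> D L"
    and pf: "p \<in> D" "f \<in> D" "p < 0" "0 < f" "p - a \<ge> int (k_max \<phi>)" "e - f \<ge> int (k_max \<phi>)"
    and lf: "\<And>y. p \<le> y \<Longrightarrow> y \<le> e \<Longrightarrow> l_requests_fulfilled D L (y, y)"
    and fut: "\<And>m. m \<in> marked_atoms \<phi> \<Longrightarrow> config \<phi> D L e m > 0 \<Longrightarrow> config \<phi> D L f m > 0"
    and rf: "\<And>x. a \<le> x \<Longrightarrow> x \<le> f \<Longrightarrow> \<exists>F h. marking \<phi> L (x, e) = (F, {}, h)"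
    and pst: "\<And>m. m \<in> marked_atoms \<phi> \<Longrightarrow> config \<phi> D L p m > 0
      \<Longrightarrow> \<exists>x. p \<le> x \<and> x \<le> 0 \<and> marking \<phi> L (x, 0) = m"
    using gen unfolding Z_compass_generator_def by (elim conjE exE) blast
  have pts: "(x, y) \<in> points D \<longleftrightarrow> a \<le> x \<and> x \<le> y \<and> y \<le> e" for x y
    by (auto simp: points_def D)
  have atom: "L (x, y) \<in> atoms \<phi>" if "a \<le> x" "x \<le> y" "y \<le> e" for x y
    using comp that unfolding compass_structure_def by (simp add: pts)
  have config_pos: "0 < config \<phi> D L y m \<longleftrightarrow> (\<exists>x. a \<le> x \<and> x \<le> y \<and> y \<le> e \<and> marking \<phi> L (x, y) = m)" for y m
  proof -
    have "finite {x. (x, y) \<in> points D \<and> marking \<phi> L (x, y) = m}"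
      by (rule finite_subset[of _ D]) (auto simp: points_def D)
    then show ?thesis unfolding config_def card_gt_0_iff pts by auto
  qed
  \<comment> \<open>Conditions (2) and (3) speak of marked atoms only, so the markings must be known
    to be such.\<close>
  have marked: "marking \<phi> L (x, y) \<in> marked_atoms \<phi>" if "a \<le> x" "x \<le> y" "y \<le> e" for x y
  proof -
    have "pending L x y \<subseteq> right_args \<phi>"
      using atom_subset_Cl[OF atom[of x x]] that
      unfolding pending_def Req_r_def right_args_def by auto
    then show ?thesis
      using atom[OF that] right_args_subset_Cl[of \<phi>] unfolding marking_eq marked_atoms_def by auto
  qed
  have "centred_generator \<phi> L a e p 0 f"
  proof
    show "L (x, y) \<in> atoms \<phi>" if "a \<le> x" "x \<le> y" "y \<le> e" for x y
      by (rule atom[OF that])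
    show "atom_rel \<phi> (L (x, y)) (L (y, w))" if "a \<le> x" "x \<le> y" "y \<le> w" "w \<le> e" for x y w
      using comp that unfolding compass_structure_def pts by auto
    show "y - x < int j" if "a \<le> x" "x \<le> y" "y \<le> e" "LenLt j \<in> L (x, y)" for x y j
      using comp that unfolding compass_structure_def pts by auto
    show "\<exists>x. a \<le> x \<and> x \<le> y \<and> \<psi> \<in> L (x, y)" if "p \<le> y" "y \<le> e" "\<psi> \<in> Req_l (L (y, y))" for y \<psi>
      using lf[OF that(1,2)] that(3) unfolding l_requests_fulfilled_def pts by auto
    show "\<exists>x'. a \<le> x' \<and> x' \<le> f \<and> marking \<phi> L (x', f) = marking \<phi> L (x, e)" if "a \<le> x" "x \<le> e" for x
      using fut[OF marked[of x e]] that unfolding config_pos by auto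
    show "pending L x e = {}" if "a \<le> x" "x \<le> f" for x
      using rf[OF that] by (simp add: marking_eq)
    show "\<exists>x'. p \<le> x' \<and> x' \<le> 0 \<and> marking \<phi> L (x', 0) = marking \<phi> L (x, p)" if "a \<le> x" "x \<le> p" for x
      using pst[OF marked[of x p]] that pf(1)[unfolded D] unfolding config_pos by auto
    show "\<exists>x y. a \<le> x \<and> x \<le> y \<and> y \<le> e \<and> norm_neg \<phi> \<in> L (x, y)"
      using feat unfolding features_def by (metis pts surj_pair)
  qed (use pf in auto)
  then show ?thesis by blast
qed

text \<open>The base \<open>b\<close> is at least 7/4, so 3 is at most its square. Hence 9^n =
  3^(2n) is at most \<open>b\<close> to the power 2 * 2^n, and the bound 4^n on twice the number of
  states raises the exponent to 2^n * 4^n = 2^(3n).\<close>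

lemma size_bound:
  fixes \<phi> :: "'p mpnl"
  shows "real ((2 * k_max \<phi> + 6) * (threshold \<phi> + 1) ^ card (states \<phi>)) \<le>
    (2 ^ (3 * mpnl_length \<phi> + 1) + 4)
      * ((real (mpnl_length \<phi>))\<^sup>2 / 4 + real (mpnl_length \<phi>) / 2 + 1) ^ (2 ^ (3 * mpnl_length \<phi>))"
proof -
  define n where "n = mpnl_length \<phi>"
  define b where "b = (real n)\<^sup>2 / 4 + real n / 2 + 1"
  have n: "1 \<le> n" using card_args_le[of \<phi>] by (simp add: n_def)
  have "(7 / 4 :: real) \<le> b"
  proof -
    have "1 \<le> real n" using n by simp
    then show ?thesis using one_le_power[of "real n" 2] unfolding b_def by linarith
  qed
  then have "3 \<le> b ^ 2" using power_mono[of "7 / 4" b 2] by (simp add: power2_eq_square)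
  have "2 * n \<le> 2 ^ n"
    using n by (induction n rule: nat_induct_at_least) auto
  have "real (threshold \<phi> + 1) \<le> 9 ^ n"
    using threshold_less[of \<phi>] unfolding n_def by (metis of_nat_le_iff of_nat_numeral of_nat_power)
  also have "\<dots> = 3 ^ (2 * n)" by (simp add: power_mult)
  also have "\<dots> \<le> 3 ^ (2 ^ n)" using \<open>2 * n \<le> 2 ^ n\<close> by (intro power_increasing) auto
  also have "\<dots> \<le> (b ^ 2) ^ (2 ^ n)" using \<open>3 \<le> b ^ 2\<close> by (intro power_mono) auto
  finally have "real (threshold \<phi> + 1) ^ card (states \<phi>) \<le> ((b ^ 2) ^ (2 ^ n)) ^ card (states \<phi>)"
    by (intro power_mono) auto
  also have "\<dots> = b ^ (2 ^ n * (2 * card (states \<phi>)))"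
    by (simp add: power_mult[symmetric] mult_ac)
  also have "\<dots> \<le> b ^ (2 ^ n * 4 ^ n)"
    using states_card(2)[of \<phi>] \<open>7 / 4 \<le> b\<close> unfolding n_def by (intro power_increasing mult_le_mono) auto
  also have "2 ^ n * 4 ^ n = (2 :: nat) ^ (3 * n)"
    by (simp add: power_mult power_mult_distrib[symmetric])
  finally have pow: "real (threshold \<phi> + 1) ^ card (states \<phi>) \<le> b ^ (2 ^ (3 * n))" .
  have "k_max \<phi> + 1 \<le> 2 ^ n"
  proof -
    have "(2 :: nat) ^ floorlog 2 (k_max \<phi>) \<le> 2 ^ n"
      using card_args_le[of \<phi>] by (intro power_increasing) (auto simp: n_def)
    then show ?thesis using k_max_less[of \<phi>] by linarith
  qed
  also have "(2 :: nat) ^ n \<le> 2 ^ (3 * n)" by (intro power_increasing) auto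
  finally have "2 * k_max \<phi> + 6 \<le> 2 ^ (3 * n + 1) + 4" by simp
  then have k: "real (2 * k_max \<phi> + 6) \<le> 2 ^ (3 * n + 1) + 4"
  proof -
    have "real (2 * k_max \<phi> + 6) \<le> real (2 ^ (3 * n + 1) + 4)"
      by (simp only: of_nat_le_iff \<open>2 * k_max \<phi> + 6 \<le> 2 ^ (3 * n + 1) + 4\<close>)
    then show ?thesis by simp
  qed
  from k pow have "real (2 * k_max \<phi> + 6) * real (threshold \<phi> + 1) ^ card (states \<phi>)
      \<le> (2 ^ (3 * n + 1) + 4) * b ^ (2 ^ (3 * n))"
    by (intro mult_mono) auto
  then show ?thesis unfolding n_def b_def by simp
qed

theorem theorem5:
  fixes \<phi> :: "'p mpnl" and D :: "int set" and L :: "int \<times> int \<Rightarrow> 'p mpnl set"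
  assumes "Z_compass_generator \<phi> D L"
    and "features D L \<phi>"
  shows "\<exists>(D' :: int set) (L' :: int \<times> int \<Rightarrow> 'p mpnl set).
           Z_compass_generator \<phi> D' L' \<and> features D' L' \<phi> \<and>
           real (card D') \<le>
             (2 ^ (3 * mpnl_length \<phi> + 1) + 4)
             * ((real (mpnl_length \<phi>))\<^sup>2 / 4 + real (mpnl_length \<phi>) / 2 + 1)
                 ^ (2 ^ (3 * mpnl_length \<phi>)) + 1"
proof -
  \<comment> \<open>The minimum ranges over all labellings and all positions of the distinguished
    rows, the centre included.\<close>
  define Q where "Q s \<longleftrightarrow> (\<exists>L a e p z f. centred_generator \<phi> L a e p z f \<and> s = nat (e - a))" for s
  have "Q s \<Longrightarrow> Q (LEAST s. Q s)" for s by (rule LeastI)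
  then have "Q (LEAST s. Q s)"
    using centred_generator_of_Z_compass_generator[OF assms] unfolding Q_def by blast
  then obtain L' a e p z f where gen: "centred_generator \<phi> L' a e p z f"
    and least: "(LEAST s. Q s) = nat (e - a)" unfolding Q_def by blast
  interpret centred_generator \<phi> L' a e p z f by (rule gen)
  have "e \<le> e'" if "centred_generator \<phi> L'' a e' p' z' f'" for L'' e' p' z' f'
  proof -
    have "Q (nat (e' - a))" using that unfolding Q_def by blast
    then have "nat (e - a) \<le> nat (e' - a)" unfolding least[symmetric] by (rule Least_le)
    then show ?thesis using bounds by linarith
  qed
  then have "card {a..e} \<le> (2 * k_max \<phi> + 6) * (threshold \<phi> + 1) ^ card (states \<phi>)"
    by (rule minimal_card)
  then have "real (card {a - z..e - z}) \<le> real ((2 * k_max \<phi> + 6) * (threshold \<phi> + 1) ^ card (states \<phi>))"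
    by (subst of_nat_le_iff) simp
  then show ?thesis
    using translated_generator size_bound[of \<phi>]
    by (intro exI[of _ "{a - z..e - z}"] exI[of _ "\<lambda>(x, y). L' (x + z, y + z)"]) auto
qed

end
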